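(* For $n>0$ there exists an embedding of $\mathfrak{osp}(1,2)[t]$-modules $W_{-n}\to W_{-n-1}$ defined by $w_{-n}\mapsto g^+_n w_{-n-1}$.
   Context: Everything is over $\mathbb{C}$. $\mathfrak{osp}(1,2)$ is the Lie superalgebra with even part $\mathfrak{sl}_2$ (standard basis $e,h,f$) and odd part with basis $g^+,g^-$; the nontrivial brackets are $[e,f]=h$, $[h,e]=2e$, $[h,f]=-2f$, $[h,g^\pm]=\pm g^\pm$, $[g^+,g^-]_+=h$, $[g^+,g^+]_+=2e$, $[g^-,g^-]_+=-2f$, $[f,g^+]=-g^-$, $[e,g^-]=-g^+$. Put $\mathfrak n^-=\mathrm{span}(f,g^-)$, $\mathfrak h=\mathbb{C}h$, $\mathfrak{osp}(1,2)[t]=\mathfrak{osp}(1,2)\otimes\mathbb{C}[t]$ and $y_i=y\otimes t^i$. The Weyl module $W_{-n}$ is the cyclic $\mathfrak{osp}(1,2)[t]$-module with generator $w_{-n}$ and defining relations $(\mathfrak n^-\oplus\mathfrak h)\otimes t\mathbb{C}[t].w_{-n}=0$, $(\mathfrak n^-\otimes 1).w_{-n}=0$, $h_0w_{-n}=-nw_{-n}$, $e_0^{n+1}w_{-n}=0$. The embedding is an injective linear map commuting with the action of $U(\mathfrak{osp}(1,2)[t])$; it is not required to preserve the $\mathbb{Z}/2$-parity. *)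

theory Defs
  imports Complex_Main "HOL-Library.Poly_Mapping"
begin

section \<open>The Lie superalgebra \<open>osp(1,2)\<close>\<close>

datatype osp12_basis = osp_e | osp_h | osp_f | osp_gp | osp_gm

lemma UNIV_osp12_basis: "UNIV = {osp_e, osp_h, osp_f, osp_gp, osp_gm}"
  by (auto intro: osp12_basis.exhaust)

instance osp12_basis :: finite
  by standard (simp add: UNIV_osp12_basis)

fun osp_odd :: "osp12_basis \<Rightarrow> bool" where
  "osp_odd osp_gp = True"
| "osp_odd osp_gm = True"
| "osp_odd _ = False"

text \<open>\<open>ssign a b\<close> is \<open>(-1)^(|a||b|)\<close> for basis vectors of parity \<open>|a|\<close>, \<open>|b|\<close>.\<close>

definition ssign :: "osp12_basis \<Rightarrow> osp12_basis \<Rightarrow> complex" where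
  "ssign a b = (if osp_odd a \<and> osp_odd b then -1 else 1)"

text \<open>The superbracket on basis vectors, with values in \<open>osp(1,2)\<close>, the space of (finitely
  supported) complex functions on the basis. The brackets between two odd vectors are the
  anticommutators.\<close>

fun osp_br :: "osp12_basis \<Rightarrow> osp12_basis \<Rightarrow> (osp12_basis \<Rightarrow>\<^sub>0 complex)" where
  "osp_br osp_e osp_f = Poly_Mapping.single osp_h 1"
| "osp_br osp_f osp_e = Poly_Mapping.single osp_h (-1)"
| "osp_br osp_h osp_e = Poly_Mapping.single osp_e 2"
| "osp_br osp_e osp_h = Poly_Mapping.single osp_e (-2)"
| "osp_br osp_h osp_f = Poly_Mapping.single osp_f (-2)"
| "osp_br osp_f osp_h = Poly_Mapping.single osp_f 2"
| "osp_br osp_h osp_gp = Poly_Mapping.single osp_gp 1"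
| "osp_br osp_gp osp_h = Poly_Mapping.single osp_gp (-1)"
| "osp_br osp_h osp_gm = Poly_Mapping.single osp_gm (-1)"
| "osp_br osp_gm osp_h = Poly_Mapping.single osp_gm 1"
| "osp_br osp_gp osp_gm = Poly_Mapping.single osp_h 1"
| "osp_br osp_gm osp_gp = Poly_Mapping.single osp_h 1"
| "osp_br osp_gp osp_gp = Poly_Mapping.single osp_e 2"
| "osp_br osp_gm osp_gm = Poly_Mapping.single osp_f (-2)"
| "osp_br osp_f osp_gp = Poly_Mapping.single osp_gm (-1)"
| "osp_br osp_gp osp_f = Poly_Mapping.single osp_gm 1"
| "osp_br osp_e osp_gm = Poly_Mapping.single osp_gp (-1)"
| "osp_br osp_gm osp_e = Poly_Mapping.single osp_gp 1"
| "osp_br _ _ = 0"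

lemma osp_br_super_antisym:
  "Poly_Mapping.lookup (osp_br b a) d = - ssign a b * Poly_Mapping.lookup (osp_br a b) d"
  by (cases a; cases b) (simp_all add: ssign_def lookup_single when_def)

text \<open>The super Jacobi identity \<open>[a,[b,c]] = [[a,b],c] + (-1)^(|a||b|) [b,[a,c]]\<close>, in
  coordinates.\<close>

lemma osp_br_super_Jacobi:
  "(\<Sum>k\<in>UNIV. Poly_Mapping.lookup (osp_br b c) k * Poly_Mapping.lookup (osp_br a k) d) =
   (\<Sum>k\<in>UNIV. Poly_Mapping.lookup (osp_br a b) k * Poly_Mapping.lookup (osp_br k c) d) +
   ssign a b * (\<Sum>k\<in>UNIV. Poly_Mapping.lookup (osp_br a c) k * Poly_Mapping.lookup (osp_br b k) d)"
  unfolding UNIV_osp12_basis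
  by (cases a; cases b; cases c; cases d; simp add: ssign_def lookup_single when_def)


section \<open>The universal enveloping algebra of \<open>osp(1,2)[t]\<close>\<close>

text \<open>A free algebra is the monoid algebra of a free monoid. The wrapper around lists makes
  concatenation the (additively written) monoid operation expected by the convolution product of
  \<^theory>\<open>HOL-Library.Poly_Mapping\<close>.\<close>

datatype 'a free_monoid = FM "'a list"

instantiation free_monoid :: (type) monoid_add
begin

definition zero_free_monoid :: "'a free_monoid" where
  "zero_free_monoid = FM []"

fun plus_free_monoid :: "'a free_monoid \<Rightarrow> 'a free_monoid \<Rightarrow> 'a free_monoid" where
  "plus_free_monoid (FM xs) (FM ys) = FM (xs @ ys)"

instance
proof
  fix a b c :: "'a free_monoid"
  show "a + b + c = a + (b + c)"
    by (cases a; cases b; cases c) simp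
  show "0 + a = a" "a + 0 = a"
    by (cases a; simp add: zero_free_monoid_def)+
qed

end

lemma free_monoid_sum_0_iff: "0 = a + b \<longleftrightarrow> a = 0 \<and> b = (0 :: 'a free_monoid)"
  by (cases a; cases b) (auto simp: zero_free_monoid_def)

text \<open>The tensor algebra of \<open>osp(1,2)[t]\<close>: the letter \<open>(y, i)\<close> is the basis vector
  \<open>y\<^sub>i = y \<otimes> t\<^sup>i\<close>.\<close>

type_synonym tosp = "(osp12_basis \<times> nat) free_monoid \<Rightarrow>\<^sub>0 complex"

definition tconst :: "complex \<Rightarrow> tosp" where
  "tconst c = Poly_Mapping.single 0 c"

definition tgen :: "osp12_basis \<Rightarrow> nat \<Rightarrow> tosp" where
  "tgen y i = Poly_Mapping.single (FM [(y, i)]) 1"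

text \<open>\<open>[a\<^sub>i, b\<^sub>j] = [a, b] \<otimes> t\<^sup>i\<^sup>+\<^sup>j\<close>, as an element of degree one of the tensor algebra.\<close>

definition tbr :: "osp12_basis \<Rightarrow> nat \<Rightarrow> osp12_basis \<Rightarrow> nat \<Rightarrow> tosp" where
  "tbr a i b j = (\<Sum>k\<in>UNIV. tconst (Poly_Mapping.lookup (osp_br a b) k) * tgen k (i + j))"

text \<open>By bilinearity, the defining relations of the enveloping algebra are only needed for basis
  vectors.\<close>

definition urel :: "osp12_basis \<Rightarrow> nat \<Rightarrow> osp12_basis \<Rightarrow> nat \<Rightarrow> tosp" where
  "urel a i b j = tgen a i * tgen b j - tconst (ssign a b) * tgen b j * tgen a i - tbr a i b j"

inductive_set two_sided_ideal :: "'r::ring_1 set \<Rightarrow> 'r set" for S where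
  zero: "0 \<in> two_sided_ideal S"
| gen: "s \<in> S \<Longrightarrow> s \<in> two_sided_ideal S"
| add: "x \<in> two_sided_ideal S \<Longrightarrow> y \<in> two_sided_ideal S \<Longrightarrow> x + y \<in> two_sided_ideal S"
| mult_left: "x \<in> two_sided_ideal S \<Longrightarrow> r * x \<in> two_sided_ideal S"
| mult_right: "x \<in> two_sided_ideal S \<Longrightarrow> x * r \<in> two_sided_ideal S"

lemma two_sided_ideal_minus: "x \<in> two_sided_ideal S \<Longrightarrow> - x \<in> two_sided_ideal S"
  using two_sided_ideal.mult_left[of x S "-1"] by simp

lemma two_sided_ideal_diff:
  "x \<in> two_sided_ideal S \<Longrightarrow> y \<in> two_sided_ideal S \<Longrightarrow> x - y \<in> two_sided_ideal S"
  using two_sided_ideal.add[of x S "- y"] two_sided_ideal_minus[of y S] by simp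

definition uideal :: "tosp set" where
  "uideal = two_sided_ideal {urel a i b j | a i b j. True}"

lemma lookup_mult_zero_free_monoid:
  fixes p q :: "'a free_monoid \<Rightarrow>\<^sub>0 complex"
  shows "Poly_Mapping.lookup (p * q) 0 = Poly_Mapping.lookup p 0 * Poly_Mapping.lookup q 0"
proof -
  have "Poly_Mapping.lookup (p * q) 0 =
      Sum_any (\<lambda>l. Poly_Mapping.lookup p l * Sum_any (\<lambda>r. Poly_Mapping.lookup q r when 0 = l + r))"
    by (rule lookup_mult)
  also have "(\<lambda>l. Poly_Mapping.lookup p l * Sum_any (\<lambda>r. Poly_Mapping.lookup q r when 0 = l + r)) =
      (\<lambda>l. Poly_Mapping.lookup p 0 * Poly_Mapping.lookup q 0 when l = 0)"
  proof
    fix l :: "'a free_monoid"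
    show "Poly_Mapping.lookup p l * Sum_any (\<lambda>r. Poly_Mapping.lookup q r when 0 = l + r) =
        (Poly_Mapping.lookup p 0 * Poly_Mapping.lookup q 0 when l = 0)"
      unfolding free_monoid_sum_0_iff by (cases "l = 0") simp_all
  qed
  finally show ?thesis
    by simp
qed

lemma one_notin_uideal: "1 \<notin> uideal"
proof -
  have gen: "Poly_Mapping.lookup (tgen y i) 0 = 0" for y i
    by (simp add: tgen_def lookup_single zero_free_monoid_def)
  have "Poly_Mapping.lookup x 0 = 0" if "x \<in> two_sided_ideal {urel a i b j | a i b j. True}" for x
    using that
  proof induction
    case (gen s)
    then show ?case
      by (auto simp: urel_def tbr_def lookup_minus lookup_mult_zero_free_monoid
          \<open>\<And>y i. Poly_Mapping.lookup (tgen y i) 0 = 0\<close> lookup_sum)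
  qed (simp_all add: lookup_add lookup_mult_zero_free_monoid)
  moreover have "Poly_Mapping.lookup (1 :: tosp) 0 \<noteq> 0"
    by (simp add: lookup_one)
  ultimately show ?thesis
    unfolding uideal_def by blast
qed

quotient_type uosp = tosp / "\<lambda>a b. a - b \<in> uideal"
proof (rule equivpI)
  show "reflp (\<lambda>a b. a - b \<in> uideal)"
    by (simp add: reflp_def uideal_def two_sided_ideal.zero)
  show "symp (\<lambda>a b. a - b \<in> uideal)"
  proof (rule sympI)
    fix a b :: tosp
    assume "a - b \<in> uideal"
    then have "- (a - b) \<in> uideal"
      unfolding uideal_def by (rule two_sided_ideal_minus)
    then show "b - a \<in> uideal"
      by simp
  qed
  show "transp (\<lambda>a b. a - b \<in> uideal)"
  proof (rule transpI)
    fix a b c :: tosp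
    assume "a - b \<in> uideal" "b - c \<in> uideal"
    then have "(a - b) + (b - c) \<in> uideal"
      unfolding uideal_def by (rule two_sided_ideal.add)
    then show "a - c \<in> uideal"
      by simp
  qed
qed

instantiation uosp :: ring_1
begin

lift_definition zero_uosp :: uosp is 0 .

lift_definition one_uosp :: uosp is 1 .

lift_definition plus_uosp :: "uosp \<Rightarrow> uosp \<Rightarrow> uosp" is "(+)"
proof -
  fix a b c d :: tosp
  assume "a - b \<in> uideal" "c - d \<in> uideal"
  then have "(a - b) + (c - d) \<in> uideal"
    unfolding uideal_def by (rule two_sided_ideal.add)
  then show "a + c - (b + d) \<in> uideal"
    by (simp add: algebra_simps)
qed

lift_definition uminus_uosp :: "uosp \<Rightarrow> uosp" is uminus
proof -
  fix a b :: tosp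
  assume "a - b \<in> uideal"
  then have "- (a - b) \<in> uideal"
    unfolding uideal_def by (rule two_sided_ideal_minus)
  then show "- a - - b \<in> uideal"
    by simp
qed

lift_definition minus_uosp :: "uosp \<Rightarrow> uosp \<Rightarrow> uosp" is minus
proof -
  fix a b c d :: tosp
  assume "a - b \<in> uideal" "c - d \<in> uideal"
  then have "(a - b) - (c - d) \<in> uideal"
    unfolding uideal_def by (rule two_sided_ideal_diff)
  then show "a - c - (b - d) \<in> uideal"
    by (simp add: algebra_simps)
qed

lift_definition times_uosp :: "uosp \<Rightarrow> uosp \<Rightarrow> uosp" is "(*)"
proof -
  fix a b c d :: tosp
  assume "a - b \<in> uideal" "c - d \<in> uideal"
  then have "(a - b) * c + b * (c - d) \<in> uideal"
    unfolding uideal_def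
    by (intro two_sided_ideal.add two_sided_ideal.mult_left two_sided_ideal.mult_right)
  then show "a * c - b * d \<in> uideal"
    by (simp add: algebra_simps)
qed

instance
proof
  fix a b c :: uosp
  have z: "0 \<in> uideal"
    by (simp add: uideal_def two_sided_ideal.zero)
  show "a * b * c = a * (b * c)" "a + b + c = a + (b + c)" "a + b = b + a"
    "0 + a = a" "- a + a = 0" "a - b = a + - b" "1 * a = a" "a * 1 = a"
    "(a + b) * c = a * c + b * c" "a * (b + c) = a * b + a * c"
    by (transfer, simp add: algebra_simps z)+
  show "(0 :: uosp) \<noteq> 1"
    using one_notin_uideal two_sided_ideal_minus[of "- 1 :: tosp"]
    by transfer (auto simp: uideal_def)
qed

end

lift_definition uconst :: "complex \<Rightarrow> uosp" is tconst .

lift_definition ugen :: "osp12_basis \<Rightarrow> nat \<Rightarrow> uosp" is tgen .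


section \<open>Cyclic modules\<close>

text \<open>The left module with one generator and defining relations \<open>s w = 0\<close> for \<open>s \<in> S\<close> is the
  quotient of the ring by the left ideal generated by \<open>S\<close>; its elements are cosets and its
  generator is the coset of 1.\<close>

inductive_set left_ideal :: "'r::ring_1 set \<Rightarrow> 'r set" for S where
  zero: "0 \<in> left_ideal S"
| gen: "s \<in> S \<Longrightarrow> s \<in> left_ideal S"
| add: "x \<in> left_ideal S \<Longrightarrow> y \<in> left_ideal S \<Longrightarrow> x + y \<in> left_ideal S"
| mult_left: "x \<in> left_ideal S \<Longrightarrow> r * x \<in> left_ideal S"

definition qcoset :: "'r::ring_1 set \<Rightarrow> 'r \<Rightarrow> 'r set" where
  "qcoset J a = {b. b - a \<in> J}"

definition qcarrier :: "'r::ring_1 set \<Rightarrow> 'r set set" where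
  "qcarrier J = range (qcoset J)"

definition qadd :: "'r::ring_1 set \<Rightarrow> 'r set \<Rightarrow> 'r set \<Rightarrow> 'r set" where
  "qadd J X Y = (\<Union>x\<in>X. \<Union>y\<in>Y. qcoset J (x + y))"

definition qact :: "'r::ring_1 set \<Rightarrow> 'r \<Rightarrow> 'r set \<Rightarrow> 'r set" where
  "qact J r X = (\<Union>x\<in>X. qcoset J (r * x))"

lemma left_ideal_minus: "x \<in> left_ideal S \<Longrightarrow> - x \<in> left_ideal S"
  using left_ideal.mult_left[of x S "-1"] by simp

lemma left_ideal_diff:
  "x \<in> left_ideal S \<Longrightarrow> y \<in> left_ideal S \<Longrightarrow> x - y \<in> left_ideal S"
  using left_ideal.add[of x S "- y"] left_ideal_minus[of y S] by simp

lemma qcoset_eq_iff: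
  "qcoset (left_ideal S) a = qcoset (left_ideal S) b \<longleftrightarrow> a - b \<in> left_ideal S"
proof
  assume "qcoset (left_ideal S) a = qcoset (left_ideal S) b"
  moreover have "a \<in> qcoset (left_ideal S) a"
    by (simp add: qcoset_def left_ideal.zero)
  ultimately show "a - b \<in> left_ideal S"
    by (simp add: qcoset_def)
next
  assume ab: "a - b \<in> left_ideal S"
  have "c - a \<in> left_ideal S \<longleftrightarrow> c - b \<in> left_ideal S" for c
    using left_ideal.add[OF _ ab, of "c - a"] left_ideal_diff[OF _ ab, of "c - b"] by auto
  then show "qcoset (left_ideal S) a = qcoset (left_ideal S) b"
    by (simp add: qcoset_def)
qed

lemma qadd_qcoset:
  "qadd (left_ideal S) (qcoset (left_ideal S) a) (qcoset (left_ideal S) b) =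
   qcoset (left_ideal S) (a + b)"
proof -
  have "qcoset (left_ideal S) (x + y) = qcoset (left_ideal S) (a + b)"
    if "x \<in> qcoset (left_ideal S) a" "y \<in> qcoset (left_ideal S) b" for x y
    using left_ideal.add[of "x - a" S "y - b"] that
    by (simp add: qcoset_eq_iff) (simp add: qcoset_def algebra_simps)
  moreover have "c \<in> qcoset (left_ideal S) c" for c
    by (simp add: qcoset_def left_ideal.zero)
  ultimately show ?thesis
    unfolding qadd_def by blast
qed

lemma qact_qcoset:
  "qact (left_ideal S) r (qcoset (left_ideal S) a) = qcoset (left_ideal S) (r * a)"
proof -
  have "qcoset (left_ideal S) (r * x) = qcoset (left_ideal S) (r * a)"
    if "x \<in> qcoset (left_ideal S) a" for x
    using left_ideal.mult_left[of "x - a" S r] that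
    by (simp add: qcoset_eq_iff) (simp add: qcoset_def algebra_simps)
  moreover have "a \<in> qcoset (left_ideal S) a"
    by (simp add: qcoset_def left_ideal.zero)
  ultimately show ?thesis
    unfolding qact_def by blast
qed


section \<open>The Weyl modules\<close>

text \<open>In everything below the index \<open>n\<close> stands for the lowest weight \<open>-n\<close>:
  \<open>weyl_J n\<close>, \<open>weyl_gen n\<close> etc. belong to \<open>W\<^sub>-\<^sub>n\<close>.\<close>

definition weyl_rels :: "nat \<Rightarrow> uosp set" where
  "weyl_rels n =
     {ugen y i | y i. y \<in> {osp_f, osp_gm, osp_h} \<and> 1 \<le> i} \<union>
     {ugen y 0 | y. y \<in> {osp_f, osp_gm}} \<union>
     {ugen osp_h 0 - uconst (- of_nat n)} \<union>
     {ugen osp_e 0 ^ (n + 1)}"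

definition weyl_J :: "nat \<Rightarrow> uosp set" where
  "weyl_J n = left_ideal (weyl_rels n)"

definition weyl :: "nat \<Rightarrow> uosp set set" where
  "weyl n = qcarrier (weyl_J n)"

definition weyl_gen :: "nat \<Rightarrow> uosp set" where
  "weyl_gen n = qcoset (weyl_J n) 1"

definition weyl_add :: "nat \<Rightarrow> uosp set \<Rightarrow> uosp set \<Rightarrow> uosp set" where
  "weyl_add n = qadd (weyl_J n)"

definition weyl_act :: "nat \<Rightarrow> uosp \<Rightarrow> uosp set \<Rightarrow> uosp set" where
  "weyl_act n = qact (weyl_J n)"

definition weyl_scale :: "nat \<Rightarrow> complex \<Rightarrow> uosp set \<Rightarrow> uosp set" where
  "weyl_scale n c = weyl_act n (uconst c)"

text \<open>Embeddings are not required to preserve parity, and no sign enters the condition that they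
  commute with odd elements.\<close>

definition weyl_embedding :: "nat \<Rightarrow> nat \<Rightarrow> (uosp set \<Rightarrow> uosp set) \<Rightarrow> bool" where
  "weyl_embedding m n \<phi> \<longleftrightarrow>
     \<phi> ` weyl m \<subseteq> weyl n \<and>
     inj_on \<phi> (weyl m) \<and>
     (\<forall>x\<in>weyl m. \<forall>y\<in>weyl m. \<phi> (weyl_add m x y) = weyl_add n (\<phi> x) (\<phi> y)) \<and>
     (\<forall>c. \<forall>x\<in>weyl m. \<phi> (weyl_scale m c x) = weyl_scale n c (\<phi> x)) \<and>
     (\<forall>u. \<forall>x\<in>weyl m. \<phi> (weyl_act m u x) = weyl_act n u (\<phi> x))"

end

theory Submission
  imports Defs
begin

text \<open>Let \<open>\<psi>, x, \<psi>\<^sup>+\<close> be the weight basis of the three-dimensional module of \<open>osp(1,2)\<close>, with \<open>\<psi>\<close> and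
  \<open>\<psi>\<^sup>+\<close> odd. The algebra \<open>osp(1,2)[t]\<close> acts by superderivations on the supercommutative algebra in the
  variables \<open>\<psi>\<^sub>j, x\<^sub>j, \<psi>\<^sup>+\<^sub>j\<close> (\<open>j \<ge> 0\<close>), \<open>t\<close> lowering indices by one. For \<open>r\<^sub>n = \<psi>\<^sub>n\<^sub>-\<^sub>1 \<cdots> \<psi>\<^sub>0\<close>, both
  \<open>r\<^sub>n\<close> and, if \<open>n > 0\<close>, \<open>r\<^sub>n x\<^sub>0\<close> satisfy the relations of \<open>w\<^sub>-\<^sub>n\<close>, and \<open>g\<^sup>+\<^sub>n r\<^sub>n\<^sub>+\<^sub>1 = r\<^sub>n x\<^sub>0\<close>.
  So it suffices that the annihilator of each of these vectors is not larger than the ideal of relations.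

  This is proved over the subalgebra \<open>I\<close> generated by \<open>e\<^sub>i, g\<^sup>+\<^sub>i, h\<^sub>i\<close> (\<open>i \<ge> 1\<close>) and \<open>f\<^sub>i, g\<^sup>-\<^sub>i\<close> (\<open>i \<ge> 0\<close>),
  since \<open>W\<^sub>-\<^sub>n\<close> is generated over it by \<open>e\<^sub>0\<^sup>n w\<^sub>-\<^sub>n\<close>. Cyclic \<open>I\<close>-modules of three kinds, with an additional relation
  \<open>e\<^sub>1\<^sup>m\<^sup>+\<^sup>1 = 0\<close>, \<open>f\<^sub>0\<^sup>m = 0\<close> or \<open>f\<^sub>0\<^sup>m g\<^sup>-\<^sub>0 = 0\<close> on the generator, are extensions of each other: the submodule
  generated by the last nonzero vector of the string is a quotient of a module of another kind, and factoring
  it out lowers \<open>m\<close> or changes the kind. On the other side, \<open>I\<close> kills \<open>\<psi>\<^sub>0\<close>, so that multiplication by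
  \<open>\<psi>\<^sub>0\<close> and taking coefficients of \<open>\<psi>\<^sub>0\<close> provide the matching maps between the explicit modules, and
  an induction on \<open>m\<close> shows that no further relations hold.\<close>

section \<open>The supercommutative algebra\<close>

datatype fock_var = fpsi | fx | fpsip

definition fodd :: "fock_var \<Rightarrow> bool" where
  "fodd v \<longleftrightarrow> v \<noteq> fx"

text \<open>The Koszul sign for moving an operator of parity \<open>b\<close> past
  \<open>v\<close>.\<close>

definition fsign :: "bool \<Rightarrow> fock_var \<Rightarrow> complex" where
  "fsign b v = (if b \<and> fodd v then -1 else 1)"

type_synonym tfock = "(fock_var \<times> nat) free_monoid \<Rightarrow>\<^sub>0 complex"

definition tlet :: "fock_var \<Rightarrow> nat \<Rightarrow> tfock" where
  "tlet v i = Poly_Mapping.single (FM [(v, i)]) 1"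

text \<open>For \<open>v = u\<close> odd and \<open>i = j\<close> the generator is twice a square,
  so odd variables square to zero in the quotient.\<close>

definition fideal :: "tfock set" where
  "fideal = two_sided_ideal
     {tlet v i * tlet u j - Poly_Mapping.single 0 (fsign (fodd v) u) * tlet u j * tlet v i | v i u j. True}"

text \<open>Taking constant terms is multiplicative and kills the relations, but not 1.\<close>

lemma one_notin_fideal: "1 \<notin> fideal"
proof -
  have gen: "Poly_Mapping.lookup (tlet v i) 0 = 0" for v i
    by (simp add: tlet_def lookup_single zero_free_monoid_def)
  have "Poly_Mapping.lookup x 0 = 0" if "x \<in> fideal" for x
    using that unfolding fideal_def
    by induction (auto simp: gen lookup_add lookup_minus lookup_mult_zero_free_monoid)
  then show ?thesis
    by (metis lookup_one when_simps(1) zero_neq_one)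
qed

quotient_type fock = tfock / "\<lambda>a b. a - b \<in> fideal"
proof (rule equivpI)
  show "reflp (\<lambda>a b. a - b \<in> fideal)"
    by (simp add: reflp_def fideal_def two_sided_ideal.zero)
  show "symp (\<lambda>a b. a - b \<in> fideal)"
    unfolding fideal_def by (rule sympI) (drule two_sided_ideal_minus, simp)
  show "transp (\<lambda>a b. a - b \<in> fideal)"
    unfolding fideal_def by (rule transpI) (drule (1) two_sided_ideal.add, simp)
qed

instantiation fock :: ring_1
begin

lift_definition zero_fock :: fock is 0 .

lift_definition one_fock :: fock is 1 .

lift_definition plus_fock :: "fock \<Rightarrow> fock \<Rightarrow> fock" is "(+)"
  unfolding fideal_def by (drule (1) two_sided_ideal.add) (simp add: algebra_simps)

lift_definition uminus_fock :: "fock \<Rightarrow> fock" is uminus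
  unfolding fideal_def by (drule two_sided_ideal_minus) simp

lift_definition minus_fock :: "fock \<Rightarrow> fock \<Rightarrow> fock" is minus
  unfolding fideal_def by (drule (1) two_sided_ideal_diff) (simp add: algebra_simps)

lift_definition times_fock :: "fock \<Rightarrow> fock \<Rightarrow> fock" is "(*)"
proof -
  fix a b c d :: tfock
  assume "a - b \<in> fideal" "c - d \<in> fideal"
  then have "(a - b) * c + b * (c - d) \<in> fideal"
    unfolding fideal_def
    by (intro two_sided_ideal.add two_sided_ideal.mult_left two_sided_ideal.mult_right)
  then show "a * c - b * d \<in> fideal"
    by (simp add: algebra_simps)
qed

instance
proof
  fix a b c :: fock
  have z: "0 \<in> fideal"
    by (simp add: fideal_def two_sided_ideal.zero)
  show "a * b * c = a * (b * c)" "a + b + c = a + (b + c)" "a + b = b + a"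
    "0 + a = a" "- a + a = 0" "a - b = a + - b" "1 * a = a" "a * 1 = a"
    "(a + b) * c = a * c + b * c" "a * (b + c) = a * b + a * c"
    by (transfer, simp add: algebra_simps z)+
  show "(0 :: fock) \<noteq> 1"
    using one_notin_fideal two_sided_ideal_minus[of "- 1 :: tfock"]
    by transfer (auto simp: fideal_def)
qed

end

lemma abs_fock_rep: "abs_fock (rep_fock z) = z"
  by (rule Quotient3_abs_rep[OF Quotient3_fock])

lemma abs_fock_cases: obtains p where "z = abs_fock p"
  by (metis abs_fock_rep)

lemma fideal_abs: "p \<in> fideal \<longleftrightarrow> abs_fock p = 0"
  by (simp add: zero_fock_def fock.abs_eq_iff)

lift_definition fconst :: "complex \<Rightarrow> fock" is "Poly_Mapping.single 0" .

lift_definition flet :: "fock_var \<Rightarrow> nat \<Rightarrow> fock" is tlet .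

lemma fconst_simps [simp]: "fconst 0 = 0" "fconst 1 = 1"
  by (simp_all add: fconst_def zero_fock_def one_fock_def single_one)

lemma fconst_add: "fconst (a + b) = fconst a + fconst b"
  by (simp add: fconst_def plus_fock.abs_eq single_add)

lemma fconst_minus: "fconst (- a) = - fconst a"
  by (metis add.right_inverse fconst_add fconst_simps(1) minus_unique)

lemma fconst_mult: "fconst (a * b) = fconst a * fconst b"
  by (simp add: fconst_def times_fock.abs_eq mult_single)

lemma fconst_of_nat: "fconst (of_nat n) = of_nat n"
  by (induction n) (simp_all add: fconst_add)

lemma fconst_m1 [simp]: "fconst (-1) = -1"
  by (simp add: fconst_minus)

lemma falg_induct [case_names single add]:
  fixes p :: "'a free_monoid \<Rightarrow>\<^sub>0 complex"
  assumes "\<And>xs c. P (Poly_Mapping.single (FM xs) c)"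
    and "\<And>p q. P p \<Longrightarrow> P q \<Longrightarrow> P (p + q)"
  shows "P p"
proof (induction p rule: update_induct)
  case const
  then show ?case using assms(1)[of "[]" 0] by simp
next
  case (update p m c)
  obtain xs where "m = FM xs" by (cases m)
  have "Poly_Mapping.update m c p = p + Poly_Mapping.single m c"
    using update(1) by (intro poly_mapping_eqI) (auto simp: lookup_update lookup_add lookup_single when_def in_keys_iff)
  then show ?case using assms update \<open>m = FM xs\<close> by metis
qed

lemma single_central:
  "Poly_Mapping.single 0 c * p = p * Poly_Mapping.single (0 :: 'a free_monoid) (c :: complex)"
  by (induction p rule: falg_induct) (simp_all add: mult_single mult.commute distrib_left distrib_right)

lemma fconst_central: "z * fconst c = fconst c * z"
  by transfer (simp add: single_central fideal_def two_sided_ideal.zero)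

lemma flet_swap: "flet v i * flet u j = fconst (fsign (fodd v) u) * flet u j * flet v i"
proof -
  have "tlet v i * tlet u j - Poly_Mapping.single 0 (fsign (fodd v) u) * tlet u j * tlet v i \<in> fideal"
    unfolding fideal_def by (rule two_sided_ideal.gen) blast
  then show ?thesis by transfer
qed

lemma abs_fock_single: "abs_fock (Poly_Mapping.single (FM xs) c) = fconst c * prod_list (map (\<lambda>(v, i). flet v i) xs)"
proof (induction xs)
  case Nil
  then show ?case by (simp add: fconst_def zero_free_monoid_def)
next
  case (Cons x xs)
  have "Poly_Mapping.single (FM (x # xs)) c = tlet (fst x) (snd x) * Poly_Mapping.single (FM xs) c"
    by (simp add: tlet_def mult_single)
  then have "abs_fock (Poly_Mapping.single (FM (x # xs)) c) = flet (fst x) (snd x) * abs_fock (Poly_Mapping.single (FM xs) c)"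
    by (simp add: flet_def times_fock.abs_eq)
  then show ?case
    by (simp add: Cons fconst_central case_prod_beta flip: mult.assoc)
qed

lemma fock_induct [case_names const letter add]:
  assumes c: "\<And>c. P (fconst c)"
    and l: "\<And>v i z. P z \<Longrightarrow> P (flet v i * z)"
    and a: "\<And>y z. P y \<Longrightarrow> P z \<Longrightarrow> P (y + z)"
  shows "P z"
proof -
  have w: "P (fconst c * prod_list (map (\<lambda>(v, i). flet v i) xs))" for c xs
  proof (induction xs)
    case (Cons x xs)
    have "fconst c * prod_list (map (\<lambda>(v, i). flet v i) (x # xs)) =
      flet (fst x) (snd x) * (fconst c * prod_list (map (\<lambda>(v, i). flet v i) xs))"
      by (simp add: case_prod_beta fconst_central flip: mult.assoc)
    then show ?case using l[OF Cons] by metis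
  qed (simp add: c)
  have "P (abs_fock p)" for p
    by (induction p rule: falg_induct) (simp_all add: abs_fock_single w a flip: plus_fock.abs_eq)
  then show ?thesis by (metis abs_fock_rep)
qed

section \<open>Linear extension from words and homomorphisms given on the variables\<close>

definition lext :: "('a free_monoid \<Rightarrow> fock) \<Rightarrow> ('a free_monoid \<Rightarrow>\<^sub>0 complex) \<Rightarrow> fock" where
  "lext f p = (\<Sum>m\<in>Poly_Mapping.keys p. fconst (Poly_Mapping.lookup p m) * f m)"

lemma lext_superset:
  assumes "finite A" "Poly_Mapping.keys p \<subseteq> A"
  shows "lext f p = (\<Sum>m\<in>A. fconst (Poly_Mapping.lookup p m) * f m)"
  unfolding lext_def using assms by (intro sum.mono_neutral_left) (auto simp: in_keys_iff)

lemma lext_add: "lext f (p + q) = lext f p + lext f q"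
proof -
  let ?A = "Poly_Mapping.keys p \<union> Poly_Mapping.keys q"
  have "lext f (p + q) = (\<Sum>m\<in>?A. fconst (Poly_Mapping.lookup (p + q) m) * f m)"
    by (intro lext_superset keys_add) simp
  also have "\<dots> = lext f p + lext f q"
    by (simp add: lext_superset[of ?A] lookup_add fconst_add distrib_right sum.distrib)
  finally show ?thesis .
qed

lemma lext_zero [simp]: "lext f 0 = 0"
  by (simp add: lext_def)

lemma lext_minus: "lext f (- p) = - lext f p"
  by (metis add.right_inverse lext_add lext_zero minus_unique)

lemma lext_diff: "lext f (p - q) = lext f p - lext f q"
  by (metis diff_conv_add_uminus lext_add lext_minus)

lemma lext_single [simp]: "lext f (Poly_Mapping.single m c) = fconst c * f m"
  by (cases "c = 0") (simp_all add: lext_def)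

definition fhomt :: "(fock_var \<Rightarrow> nat \<Rightarrow> fock) \<Rightarrow> tfock \<Rightarrow> fock" where
  "fhomt \<phi> = lext (\<lambda>w. case w of FM xs \<Rightarrow> prod_list (map (case_prod \<phi>) xs))"

lemma fhomt_mult: "fhomt \<phi> (p * q) = fhomt \<phi> p * fhomt \<phi> q"
proof (induction p rule: falg_induct)
  case (single xs c)
  show ?case
  proof (induction q rule: falg_induct)
    case (single ys d)
    show ?case
      by (simp add: fhomt_def mult_single fconst_mult mult.assoc)
        (metis fconst_central mult.assoc)
  qed (simp add: fhomt_def lext_add distrib_left)
qed (simp add: fhomt_def lext_add distrib_right)

text \<open>Under \<open>fhom_ok\<close> the value does not depend on the chosen representative, see
  \<open>fhom_abs\<close>.\<close>

definition fhom :: "(fock_var \<Rightarrow> nat \<Rightarrow> fock) \<Rightarrow> fock \<Rightarrow> fock" where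
  "fhom \<phi> z = fhomt \<phi> (rep_fock z)"

definition fhom_ok :: "(fock_var \<Rightarrow> nat \<Rightarrow> fock) \<Rightarrow> bool" where
  "fhom_ok \<phi> \<longleftrightarrow> (\<forall>v i u j. \<phi> v i * \<phi> u j = fconst (fsign (fodd v) u) * \<phi> u j * \<phi> v i)"

lemma fhomt_basic: "fhomt \<phi> (p + q) = fhomt \<phi> p + fhomt \<phi> q" "fhomt \<phi> (p - q) = fhomt \<phi> p - fhomt \<phi> q"
  "fhomt \<phi> 0 = 0" "fhomt \<phi> (tlet v i) = \<phi> v i" "fhomt \<phi> (Poly_Mapping.single 0 c) = fconst c"
  by (simp_all add: fhomt_def lext_add lext_diff tlet_def zero_free_monoid_def)

lemma fhomt_ideal:
  assumes ok: "fhom_ok \<phi>" and p: "p \<in> fideal"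
  shows "fhomt \<phi> p = 0"
  using p unfolding fideal_def
proof induction
  case (gen s)
  then show ?case
    using ok by (auto simp: fhomt_basic fhomt_mult fhom_ok_def)
qed (simp_all add: fhomt_basic fhomt_mult)

lemma abs_rep_fideal: "rep_fock (abs_fock p) - p \<in> fideal"
  by (metis abs_fock_rep fock.abs_eq_iff)

lemma fhom_abs: "fhom_ok \<phi> \<Longrightarrow> fhom \<phi> (abs_fock p) = fhomt \<phi> p"
  using fhomt_ideal[OF _ abs_rep_fideal, of \<phi> p] by (simp add: fhom_def fhomt_basic)

context
  fixes \<phi>
  assumes ok: "fhom_ok \<phi>"
begin

lemma fhom_add: "fhom \<phi> (y + z) = fhom \<phi> y + fhom \<phi> z"
  by (cases y rule: abs_fock_cases; cases z rule: abs_fock_cases) (simp add: fhom_abs ok plus_fock.abs_eq fhomt_basic)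

lemma fhom_mult: "fhom \<phi> (y * z) = fhom \<phi> y * fhom \<phi> z"
  by (cases y rule: abs_fock_cases; cases z rule: abs_fock_cases) (simp add: fhom_abs ok times_fock.abs_eq fhomt_mult)

lemma fhom_const: "fhom \<phi> (fconst c) = fconst c"
  by (simp add: fconst.abs_eq fhom_abs ok fhomt_basic)

lemma fhom_let: "fhom \<phi> (flet v i) = \<phi> v i"
  by (simp add: flet.abs_eq fhom_abs ok fhomt_basic)

end

lemma fsign_sq [simp]: "fsign b v * fsign b v = 1"
  by (simp add: fsign_def)

lemma fconst_left_commute: "y * (fconst c * z) = fconst c * (y * z)"
  by (metis fconst_central mult.assoc)

section \<open>Superderivations and the action of \<open>osp(1,2)[t]\<close>\<close>

text \<open>The parity automorphism for \<open>b\<close> true and the identity for \<open>b\<close>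
  false; it supplies the sign in the Leibniz rule of a derivation of parity
  \<open>b\<close>.\<close>

definition fpar :: "bool \<Rightarrow> fock \<Rightarrow> fock" where
  "fpar b = fhom (\<lambda>v i. fconst (fsign b v) * flet v i)"

lemma fpar_ok: "fhom_ok (\<lambda>v i. fconst (fsign b v) * flet v i)"
proof -
  have "(c * y) * (d * z) = e * (d * z) * (c * y)"
    if "y * z = e * z * y" "\<And>x. x * c = c * x" "\<And>x. x * d = d * x" "\<And>x. x * e = e * x"
    for c d e y z :: fock
    by (metis that mult.assoc)
  then show ?thesis
    unfolding fhom_ok_def by (blast intro: flet_swap fconst_central)
qed

lemmas fpar_add = fhom_add[OF fpar_ok, folded fpar_def]
  and fpar_mult = fhom_mult[OF fpar_ok, folded fpar_def]
  and fpar_const [simp] = fhom_const[OF fpar_ok, folded fpar_def]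
  and fpar_let [simp] = fhom_let[OF fpar_ok, folded fpar_def]

primrec fderw :: "bool \<Rightarrow> (fock_var \<Rightarrow> nat \<Rightarrow> fock) \<Rightarrow> (fock_var \<times> nat) list \<Rightarrow> fock" where
  "fderw b d [] = 0"
| "fderw b d (x # xs) = case_prod d x * prod_list (map (case_prod flet) xs) +
     fconst (fsign b (fst x)) * case_prod flet x * fderw b d xs"

definition fdert :: "bool \<Rightarrow> (fock_var \<Rightarrow> nat \<Rightarrow> fock) \<Rightarrow> tfock \<Rightarrow> fock" where
  "fdert b d = lext (\<lambda>w. case w of FM xs \<Rightarrow> fderw b d xs)"

lemma fderw_append:
  "fderw b d (xs @ ys) = fderw b d xs * prod_list (map (case_prod flet) ys) +
     prod_list (map (\<lambda>(v, i). fconst (fsign b v) * flet v i) xs) * fderw b d ys"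
  by (induction xs) (auto simp: algebra_simps)

lemma fpar_abs: "fpar b (abs_fock p) = fhomt (\<lambda>v i. fconst (fsign b v) * flet v i) p"
  unfolding fpar_def by (rule fhom_abs[OF fpar_ok])

lemma fdert_mult: "fdert b d (p * q) = fdert b d p * abs_fock q + fpar b (abs_fock p) * fdert b d q"
proof (induction p rule: falg_induct)
  case (single xs c)
  have fpar: "fpar b (abs_fock (Poly_Mapping.single (FM xs) c)) =
      fconst c * prod_list (map (\<lambda>(v, i). fconst (fsign b v) * flet v i) xs)"
    by (simp add: fpar_abs fhomt_def)
  show ?case
    unfolding fpar
  proof (induction q rule: falg_induct)
    case (single ys e)
    show ?case
      by (simp add: fdert_def mult_single fconst_mult abs_fock_single fderw_append
          distrib_left mult.assoc fconst_left_commute[of "fderw b d xs"]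
          fconst_left_commute[of "prod_list zs" for zs])
  qed (simp add: fdert_def lext_add distrib_left algebra_simps plus_fock.abs_eq[symmetric])
qed (simp add: fdert_def lext_add distrib_right algebra_simps plus_fock.abs_eq[symmetric] fpar_add)

lemma fdert_basic: "fdert b d (p + q) = fdert b d p + fdert b d q" "fdert b d (p - q) = fdert b d p - fdert b d q"
  "fdert b d 0 = 0" "fdert b d (tlet v i) = d v i" "fdert b d (Poly_Mapping.single 0 c) = 0"
  by (simp_all add: fdert_def lext_add lext_diff tlet_def zero_free_monoid_def)

definition fder :: "bool \<Rightarrow> (fock_var \<Rightarrow> nat \<Rightarrow> fock) \<Rightarrow> fock \<Rightarrow> fock" where
  "fder b d z = fdert b d (rep_fock z)"

text \<open>\<open>d\<close> shifts the parity of the variables by \<open>b\<close>.\<close>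

definition fder_ok :: "bool \<Rightarrow> (fock_var \<Rightarrow> nat \<Rightarrow> fock) \<Rightarrow> bool" where
  "fder_ok b d \<longleftrightarrow> (\<forall>v i u j. d v i * flet u j = fconst (fsign (fodd v \<noteq> b) u) * flet u j * d v i)"

text \<open>On a generator the signs of the two Leibniz expansions cancel by \<open>fder_ok\<close>.
  On multiples the Leibniz rule leaves a term containing the element itself, which is zero in the
  quotient.\<close>

lemma fdert_ideal:
  assumes ok: "fder_ok b d" and p: "p \<in> fideal"
  shows "fdert b d p = 0"
  using p unfolding fideal_def
proof induction
  case (gen s)
  then obtain v i u j where s: "s = tlet v i * tlet u j - Poly_Mapping.single 0 (fsign (fodd v) u) * tlet u j * tlet v i"
    by blast
  have "d v i * flet u j = fconst (fsign (fodd v \<noteq> b) u) * flet u j * d v i"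
    "d u j * flet v i = fconst (fsign (fodd u \<noteq> b) v) * flet v i * d u j"
    using ok unfolding fder_ok_def by blast+
  then have "d v i * flet u j + fconst (fsign b v) * flet v i * d u j -
     fconst (fsign (fodd v) u) * (d u j * flet v i + fconst (fsign b u) * flet u j * d v i) = 0"
    by (cases b; cases "fodd v"; cases "fodd u") (simp_all add: fsign_def)
  then show ?case
    by (simp add: s fdert_basic fdert_mult times_fock.abs_eq[symmetric] flet.abs_eq[symmetric]
        fpar_mult fconst.abs_eq[symmetric] algebra_simps)
next
  case (mult_left x r)
  then have "abs_fock x = 0" by (simp add: fideal_def flip: fideal_abs)
  then show ?case using mult_left by (simp add: fdert_mult)
next
  case (mult_right x r)
  then have "abs_fock x = 0" by (simp add: fideal_def flip: fideal_abs)
  then show ?case using mult_right fpar_const[of b 0] by (simp add: fdert_mult)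
qed (simp_all add: fdert_basic)

lemma fder_abs: "fder_ok b d \<Longrightarrow> fder b d (abs_fock p) = fdert b d p"
  using fdert_ideal[OF _ abs_rep_fideal, of b d p] by (simp add: fder_def fdert_basic)

context
  fixes b d
  assumes ok: "fder_ok b d"
begin

lemma fder_add: "fder b d (y + z) = fder b d y + fder b d z"
  by (cases y rule: abs_fock_cases; cases z rule: abs_fock_cases)
    (simp add: fder_abs ok plus_fock.abs_eq fdert_basic)

lemma fder_mult: "fder b d (y * z) = fder b d y * z + fpar b y * fder b d z"
  by (cases y rule: abs_fock_cases; cases z rule: abs_fock_cases)
    (simp add: fder_abs ok times_fock.abs_eq fdert_mult)

lemma fder_const [simp]: "fder b d (fconst c) = 0"
  by (simp add: fconst.abs_eq fder_abs ok fdert_basic)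

lemma fder_let: "fder b d (flet v i) = d v i"
  by (simp add: flet.abs_eq fder_abs ok fdert_basic)

lemma fder_cmult: "fder b d (fconst c * z) = fconst c * fder b d z"
  by (simp add: fder_mult)

end

text \<open>\<open>y v = oact y v \<cdot> otgt y v\<close>, the basis being normalized by \<open>x = g\<^sup>+ \<psi>\<close> and \<open>\<psi>\<^sup>+ = e \<psi>\<close>.\<close>

primrec oact :: "osp12_basis \<Rightarrow> fock_var \<Rightarrow> complex" where
  "oact osp_e v = (if v = fpsi then 1 else 0)"
| "oact osp_f v = (if v = fpsip then 1 else 0)"
| "oact osp_h v = (if v = fpsi then -1 else if v = fpsip then 1 else 0)"
| "oact osp_gp v = (if v = fpsip then 0 else 1)"
| "oact osp_gm v = (if v = fx then -1 else if v = fpsip then 1 else 0)"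

primrec otgt :: "osp12_basis \<Rightarrow> fock_var \<Rightarrow> fock_var" where
  "otgt osp_e v = fpsip"
| "otgt osp_f v = fpsi"
| "otgt osp_h v = v"
| "otgt osp_gp v = (if v = fpsi then fx else fpsip)"
| "otgt osp_gm v = (if v = fx then fpsi else fx)"

definition olet :: "osp12_basis \<Rightarrow> nat \<Rightarrow> fock_var \<Rightarrow> nat \<Rightarrow> fock" where
  "olet y i v j = (if i \<le> j then fconst (oact y v) * flet (otgt y v) (j - i) else 0)"

definition oder :: "osp12_basis \<Rightarrow> nat \<Rightarrow> fock \<Rightarrow> fock" where
  "oder y i = fder (osp_odd y) (olet y i)"

text \<open>Where \<open>oact\<close> vanishes, \<open>otgt\<close> is a placeholder and may have
  the wrong parity, hence the hypothesis.\<close>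

lemma otgt_odd: "oact y v \<noteq> 0 \<Longrightarrow> fodd (otgt y v) \<longleftrightarrow> fodd v \<noteq> osp_odd y"
  by (cases y; cases v) (simp_all add: fodd_def)

lemma olet_ok: "fder_ok (osp_odd y) (olet y i)"
proof -
  have "fconst (oact y v) * flet (otgt y v) (j - i) * flet u k =
    fconst (fsign (fodd v \<noteq> osp_odd y) u) * flet u k * (fconst (oact y v) * flet (otgt y v) (j - i))"
    for v j u k
  proof (cases "oact y v = 0")
    case False
    then show ?thesis
      using flet_swap[of "otgt y v" "j - i" u k] unfolding otgt_odd[OF False]
      by (metis fconst_central mult.assoc)
  qed simp
  then show ?thesis
    unfolding fder_ok_def olet_def by simp
qed

lemmas oder_add = fder_add[OF olet_ok, folded oder_def]
  and oder_mult = fder_mult[OF olet_ok, folded oder_def]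
  and oder_const [simp] = fder_const[OF olet_ok, folded oder_def]
  and oder_let = fder_let[OF olet_ok, folded oder_def]
  and oder_cmult = fder_cmult[OF olet_ok, folded oder_def]

lemma oder_zero [simp]: "oder y i 0 = 0"
  using oder_const[of y i 0] by simp

lemma fpar_zero [simp]: "fpar b 0 = 0"
  using fpar_const[of b 0] by simp

text \<open>Both sides depend on the indices only through i + j, so a finite check in the
  three-dimensional representation remains.\<close>

lemma oder_olet:
  "oder a i (olet b j v m) = fconst (ssign a b) * oder b j (olet a i v m) +
     (\<Sum>k\<in>UNIV. fconst (Poly_Mapping.lookup (osp_br a b) k) * olet k (i + j) v m)"
proof -
  have D: "oder a i (olet b j v m) = (if i + j \<le> m then
      fconst (oact b v * oact a (otgt b v)) * flet (otgt a (otgt b v)) (m - (i + j)) else 0)"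
    for a b i j v m
    by (auto simp: olet_def oder_cmult oder_let fconst_mult mult.assoc add.commute diff_diff_left)
  have two: "fconst 2 * y = y + y" for y
    using fconst_add[of 1 1] by (simp add: mult_2)
  have "i + j \<le> m \<Longrightarrow> ?thesis"
    unfolding D unfolding UNIV_osp12_basis olet_def
    by (cases a; cases b; cases v; simp add: two lookup_single when_def ssign_def add.commute fconst_minus
        flip: distrib_right fconst_add fconst_mult mult.assoc)
  moreover have "\<not> i + j \<le> m \<Longrightarrow> ?thesis"
    unfolding D by (simp add: olet_def add.commute)
  ultimately show ?thesis by blast
qed

lemma fpar_olet: "fpar (osp_odd a) (olet b j v m) = fconst (fsign (osp_odd a) v * ssign a b) * olet b j v m"
  by (cases "oact b v = 0")
    (auto simp: olet_def fpar_mult fsign_def otgt_odd ssign_def fconst_central)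

lemma osp_br_odd: "Poly_Mapping.lookup (osp_br a b) k \<noteq> 0 \<Longrightarrow> osp_odd k \<longleftrightarrow> osp_odd a \<noteq> osp_odd b"
  by (cases a; cases b) (auto simp: lookup_single when_def split: if_splits)

text \<open>The supercommutator of two superderivations is again a superderivation, so agreement on
  the variables, which is \<open>oder_olet\<close>, propagates to products.\<close>

lemma oder_bracket:
  "oder a i (oder b j z) = fconst (ssign a b) * oder b j (oder a i z) +
     (\<Sum>k\<in>UNIV. fconst (Poly_Mapping.lookup (osp_br a b) k) * oder k (i + j) z)"
proof (induction z rule: fock_induct)
  case (letter v m z)
  let ?c = "Poly_Mapping.lookup (osp_br a b)"
  let ?s = "fsign (osp_odd a) v" and ?t = "fsign (osp_odd b) v"
  let ?l = "flet v m"
  have one: "oder y i (?l * z) = olet y i v m * z + fconst (fsign (osp_odd y) v) * ?l * oder y i z" for y i z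
    by (simp add: oder_mult oder_let)
  \<comment> \<open>The two mixed terms agree up to the factor \<open>ssign a b\<close> with those
    of the expansion with \<open>a\<close> and \<open>b\<close> exchanged, so they cancel in the
    supercommutator.\<close>
  have two: "oder a i (oder b j (?l * z)) = oder a i (olet b j v m) * z
      + fconst (fsign (osp_odd a) v) * (fconst (ssign a b) * (olet b j v m * oder a i z))
      + fconst (fsign (osp_odd b) v) * (olet a i v m * oder b j z)
      + fconst (fsign (osp_odd a) v) * (fconst (fsign (osp_odd b) v) * (?l * oder a i (oder b j z)))" for a b i j
    by (simp add: one oder_add oder_mult fpar_olet oder_cmult mult.assoc oder_let fconst_mult distrib_left fpar_mult
        fconst_left_commute[of "flet _ _"] fconst_left_commute[of "olet _ _ _ _"])
      (metis fconst_left_commute)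
  \<comment> \<open>A nonzero structure constant forces the parity of \<open>k\<close> to be the sum
    of the parities of \<open>a\<close> and \<open>b\<close>.\<close>
  have sk: "fconst (?c k) * oder k (i + j) (?l * z) =
      fconst (?c k) * (olet k (i + j) v m * z) + fconst ?s * (fconst ?t * (?l * (fconst (?c k) * oder k (i + j) z)))" for k
  proof (cases "?c k = 0")
    case False
    then have "fsign (osp_odd k) v = fsign (osp_odd a) v * fsign (osp_odd b) v"
      by (simp add: osp_br_odd fsign_def)
    then show ?thesis
      by (simp add: one distrib_left mult.assoc fconst_mult) (metis fconst_left_commute)
  qed simp
  have br: "fconst (ssign a b) * fconst (ssign a b) = 1" "ssign b a = ssign a b"
    by (simp_all add: ssign_def flip: fconst_mult)
  have br': "fconst (ssign a b) * (fconst (ssign a b) * y) = y" for y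
    by (simp add: br flip: mult.assoc)
  have "(\<Sum>k\<in>UNIV. fconst (?c k) * oder k (i + j) (?l * z)) =
      (\<Sum>k\<in>UNIV. fconst (?c k) * olet k (i + j) v m) * z +
      fconst ?s * (fconst ?t * (?l * (\<Sum>k\<in>UNIV. fconst (?c k) * oder k (i + j) z)))"
    unfolding sk by (simp add: sum.distrib sum_distrib_left sum_distrib_right mult.assoc)
  then show ?case
    unfolding two oder_olet[of a i b j] letter
    by (simp add: distrib_left distrib_right mult.assoc br br' add_ac fconst_left_commute[of "fconst d" for d]
        fconst_left_commute[of "flet v m"])
next
  case (add y z)
  then show ?case
    by (simp add: oder_add distrib_left sum.distrib algebra_simps)
qed simp

section \<open>The action of the enveloping algebra\<close>

definition actt :: "tosp \<Rightarrow> fock \<Rightarrow> fock" where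
  "actt p z = lext (\<lambda>w. case w of FM ws \<Rightarrow> foldr (case_prod oder) ws z) p"

lemma foldr_oder_add: "foldr (case_prod oder) ws (y + z) = foldr (case_prod oder) ws y + foldr (case_prod oder) ws z"
  by (induction ws) (auto simp: oder_add)

lemma foldr_oder_cmult: "foldr (case_prod oder) ws (fconst c * z) = fconst c * foldr (case_prod oder) ws z"
  by (induction ws) (auto simp: oder_cmult)

lemma actt_basic:
  "actt (p + q) z = actt p z + actt q z" "actt (p - q) z = actt p z - actt q z" "actt 0 z = 0"
  "actt (tgen y i) z = oder y i z" "actt (tconst c) z = fconst c * z"
  by (simp_all add: actt_def lext_add lext_diff tgen_def tconst_def zero_free_monoid_def)

lemma actt_add: "actt p (y + z) = actt p y + actt p z"
  by (induction p rule: falg_induct) (simp_all add: actt_def lext_add foldr_oder_add distrib_left)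

lemma actt_zero [simp]: "actt p 0 = 0"
  using actt_add[of p 0 0] by simp

lemma actt_cmult: "actt p (fconst c * z) = fconst c * actt p z"
  by (induction p rule: falg_induct)
    (simp_all add: actt_def lext_add foldr_oder_cmult distrib_left
      fconst_left_commute[of "fconst d" for d])

lemma actt_mult: "actt (p * q) z = actt p (actt q z)"
proof (induction p rule: falg_induct)
  case (single xs c)
  show ?case
  proof (induction q rule: falg_induct)
    case (single ys e)
    show ?case
      by (simp add: actt_def mult_single fconst_mult foldr_oder_cmult mult.assoc)
  next
    case (add p q)
    then show ?case by (simp add: distrib_left actt_basic actt_add)
  qed
qed (simp add: distrib_right actt_basic)

lemma actt_sum: "actt (\<Sum>k\<in>A. p k) z = (\<Sum>k\<in>A. actt (p k) z)"
  by (induction A rule: infinite_finite_induct) (simp_all add: actt_basic)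

lemma actt_uideal:
  assumes "p \<in> uideal"
  shows "actt p z = 0"
  using assms unfolding uideal_def
proof (induction arbitrary: z)
  case (gen s)
  then obtain a i b j where "s = urel a i b j" by blast
  then show ?case
    using oder_bracket[of a i b j z]
    by (simp add: urel_def tbr_def actt_basic actt_mult actt_sum)
qed (simp_all add: actt_basic actt_mult)

definition act :: "uosp \<Rightarrow> fock \<Rightarrow> fock" where
  "act u z = actt (rep_uosp u) z"

lemma abs_uosp_rep: "abs_uosp (rep_uosp z) = z"
  by (rule Quotient3_abs_rep[OF Quotient3_uosp])

lemma abs_uosp_cases: obtains p where "z = abs_uosp p"
  by (metis abs_uosp_rep)

lemma act_abs: "act (abs_uosp p) z = actt p z"
proof -
  have "rep_uosp (abs_uosp p) - p \<in> uideal"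
    by (metis abs_uosp_rep uosp.abs_eq_iff)
  from actt_uideal[OF this, of z] show ?thesis
    by (simp add: act_def actt_basic)
qed

lemma act_plus: "act (u + v) z = act u z + act v z"
  by (cases u rule: abs_uosp_cases; cases v rule: abs_uosp_cases)
    (simp add: plus_uosp.abs_eq act_abs actt_basic)

lemma act_minus: "act (u - v) z = act u z - act v z"
  by (cases u rule: abs_uosp_cases; cases v rule: abs_uosp_cases)
    (simp add: minus_uosp.abs_eq act_abs actt_basic)

lemma act_mult: "act (u * v) z = act u (act v z)"
  by (cases u rule: abs_uosp_cases; cases v rule: abs_uosp_cases)
    (simp add: times_uosp.abs_eq act_abs actt_mult)

lemma act_const: "act (uconst c) z = fconst c * z"
  by (simp add: uconst.abs_eq act_abs actt_basic)

lemma act_gen: "act (ugen y i) z = oder y i z"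
  by (simp add: ugen.abs_eq act_abs actt_basic)

lemma act_cmult: "act u (fconst c * z) = fconst c * act u z"
  by (simp add: act_def actt_cmult)

lemma act_zero_right [simp]: "act u 0 = 0"
  by (simp add: act_def)

lemma act_zero_left [simp]: "act 0 z = 0"
  using act_plus[of 0 0] by simp

lemma act_one [simp]: "act 1 z = z"
  by (simp add: one_uosp_def act_abs actt_def single_one[symmetric] zero_free_monoid_def del: single_one)

lemma fpar_False [simp]: "fpar False z = z"
  by (induction z rule: fock_induct) (simp_all add: fpar_add fpar_mult fsign_def)

lemma fpar_fpar [simp]: "fpar b (fpar b z) = z"
proof (induction z rule: fock_induct)
  case (letter v i z)
  then show ?case
    by (simp add: fpar_mult flip: mult.assoc fconst_mult)
qed (simp_all add: fpar_add)

section \<open>Taking coefficients\<close>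

text \<open>The quotient by the variables of index zero, identified with the whole algebra again.
  The action depends only on index differences, so it commutes with this map.\<close>

definition fshift :: "fock \<Rightarrow> fock" where
  "fshift = fhom (\<lambda>v i. if i = 0 then 0 else flet v (i - 1))"

lemma fshift_ok: "fhom_ok (\<lambda>v i. if i = 0 then 0 else flet v (i - 1))"
  by (simp add: fhom_ok_def flet_swap)

lemmas fshift_add = fhom_add[OF fshift_ok, folded fshift_def]
  and fshift_mult = fhom_mult[OF fshift_ok, folded fshift_def]
  and fshift_const [simp] = fhom_const[OF fshift_ok, folded fshift_def]
  and fshift_let = fhom_let[OF fshift_ok, folded fshift_def]

lemma fshift_zero [simp]: "fshift 0 = 0" and fshift_one [simp]: "fshift 1 = 1"
  using fshift_const[of 0] fshift_const[of 1] by simp_all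

lemma fshift_let_simps [simp]: "fshift (flet v 0) = 0" "fshift (flet v (Suc i)) = flet v i"
  by (simp_all add: fshift_let)

lemma fshift_fpar: "fshift (fpar b z) = fpar b (fshift z)"
  by (induction z rule: fock_induct) (simp_all add: fpar_add fpar_mult fshift_add fshift_mult fshift_let)

lemma fshift_oder: "fshift (oder y i z) = oder y i (fshift z)"
proof (induction z rule: fock_induct)
  case (letter v j z)
  have "fshift (olet y i v j) = oder y i (fshift (flet v j))"
    by (auto simp: fshift_let oder_let olet_def fshift_mult)
  with letter show ?case
    by (simp add: oder_mult oder_let fshift_add fshift_mult flip: fshift_fpar)
qed (simp_all add: oder_add fshift_add)

lemma flet_fx_central: "z * flet fx i = flet fx i * z"
proof (induction z rule: fock_induct)
  case (letter v j z)
  have "flet v j * flet fx i = flet fx i * flet v j"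
    using flet_swap[of v j fx i] by (simp add: fsign_def fodd_def)
  with letter show ?case by (metis mult.assoc)
qed (simp_all add: fconst_central distrib_left distrib_right)

lemma flet_odd_sq:
  assumes "fodd v"
  shows "flet v i * flet v i = 0"
proof -
  have "flet v i * flet v i = - (flet v i * flet v i)"
    using flet_swap[of v i v i] assms by (simp add: fsign_def)
  then have "flet v i * flet v i + flet v i * flet v i = 0"
    by (metis add.right_inverse)
  then have "fconst 2 * (flet v i * flet v i) = 0"
    using fconst_add[of 1 1] by (simp add: mult_2)
  then have "fconst (1/2) * (fconst 2 * (flet v i * flet v i)) = 0"
    by simp
  then show ?thesis
    by (simp flip: mult.assoc fconst_mult)
qed

text \<open>The partial derivative in the variable \<open>v\<close> of index zero, as a
  superderivation.\<close>

definition fpd :: "fock_var \<Rightarrow> fock \<Rightarrow> fock" where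
  "fpd v = fder (fodd v) (\<lambda>u i. if u = v \<and> i = 0 then 1 else 0)"

lemma fpd_ok: "fder_ok (fodd v) (\<lambda>u i. if u = v \<and> i = 0 then 1 else 0)"
  by (auto simp: fder_ok_def fsign_def)

lemmas fpd_add = fder_add[OF fpd_ok, folded fpd_def]
  and fpd_mult = fder_mult[OF fpd_ok, folded fpd_def]
  and fpd_const [simp] = fder_const[OF fpd_ok, folded fpd_def]
  and fpd_let = fder_let[OF fpd_ok, folded fpd_def]
  and fpd_cmult = fder_cmult[OF fpd_ok, folded fpd_def]

lemma fpd_zero [simp]: "fpd v 0 = 0"
  using fpd_const[of v 0] by simp

lemma fpd_x_power: "fpd fx (flet fx 0 ^ Suc j) = fconst (of_nat (Suc j)) * flet fx 0 ^ j"
proof (induction j)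
  case (Suc j)
  have "fpd fx (flet fx 0 ^ Suc (Suc j)) = flet fx 0 ^ Suc j + flet fx 0 * fpd fx (flet fx 0 ^ Suc j)"
    unfolding power_Suc[of _ "Suc j"] fpd_mult by (simp add: fpd_let fodd_def fsign_def)
  also have "\<dots> = flet fx 0 ^ Suc j + fconst (of_nat (Suc j)) * flet fx 0 ^ Suc j"
    unfolding Suc by (simp add: fconst_left_commute[of "flet fx 0"])
  finally show ?case
    using fconst_add[of 1 1] by (simp add: fconst_add distrib_right mult_2)
qed (simp add: fpd_let)

text \<open>A derivative that lands on \<open>z\<close> leaves a factor x_0 over, so modulo x_0 only
  the j! ways of differentiating the power count.\<close>

lemma fpd_x_iter: "\<exists>b. (fpd fx ^^ j) (z * flet fx 0 ^ j) = fconst (fact j) * z + b * flet fx 0"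
proof (induction j arbitrary: z)
  case 0
  show ?case by (simp add: exI[of _ 0])
next
  case (Suc j)
  let ?x = "flet fx 0"
  have iter: "(fpd fx ^^ j) (y + fconst c * y') = (fpd fx ^^ j) y + fconst c * (fpd fx ^^ j) y'" for j y c y'
    by (induction j) (simp_all add: fpd_add fpd_cmult)
  have "fpd fx (z * ?x ^ Suc j) = (fpd fx z * ?x) * ?x ^ j + fconst (of_nat (Suc j)) * (z * ?x ^ j)"
    unfolding fpd_mult fpd_x_power by (simp add: fodd_def fconst_left_commute[of z] mult.assoc)
  then have "(fpd fx ^^ Suc j) (z * ?x ^ Suc j) =
     (fpd fx ^^ j) ((fpd fx z * ?x) * ?x ^ j) + fconst (of_nat (Suc j)) * (fpd fx ^^ j) (z * ?x ^ j)"
    by (simp only: funpow_Suc_right o_apply iter)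
  moreover obtain b where "(fpd fx ^^ j) ((fpd fx z * ?x) * ?x ^ j) = fconst (fact j) * (fpd fx z * ?x) + b * ?x"
    using Suc by blast
  moreover obtain b' where "(fpd fx ^^ j) (z * ?x ^ j) = fconst (fact j) * z + b' * ?x"
    using Suc by blast
  ultimately have "(fpd fx ^^ Suc j) (z * ?x ^ Suc j) = fconst (fact (Suc j)) * z +
     (fconst (fact j) * fpd fx z + b + fconst (of_nat (Suc j)) * b') * ?x"
    by (simp add: distrib_left distrib_right mult.assoc fconst_mult fconst_add)
  then show ?case by blast
qed

definition fq :: "nat \<Rightarrow> fock" where
  "fq j = flet fpsi 0 * flet fx 0 ^ j"

text \<open>Differentiating j times in x_0 and once in \<psi>_0 exposes \<open>z\<close>, up to the
  parity automorphism, modulo x_0 and \<psi>_0. Working modulo both is enough because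
  \<open>fshift\<close> kills both.\<close>

lemma fq_zero_divisor:
  assumes "z * fq j = 0"
  shows "\<exists>b c. z = b * flet fx 0 + c * flet fpsi 0"
proof -
  let ?x = "flet fx 0" and ?p = "flet fpsi 0"
  obtain b where b: "(fpd fx ^^ j) (z * ?p * ?x ^ j) = fconst (fact j) * (z * ?p) + b * ?x"
    using fpd_x_iter by blast
  have par: "fpar True (y * ?p + y' * ?x) = fpar True y' * ?x + (- fpar True y) * ?p" for y y'
    by (simp add: fpar_add fpar_mult fsign_def fodd_def)
  have "(fpd fx ^^ j) 0 = 0"
    by (induction j) simp_all
  with b assms have "fconst (fact j) * (z * ?p) + b * ?x = 0"
    by (simp add: fq_def mult.assoc)
  then have "fpd fpsi (fconst (fact j) * (z * ?p) + b * ?x) = 0"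
    by simp
  then have "fconst (fact j) * (fpd fpsi z * ?p + fpar True z) + fpd fpsi b * ?x = 0"
    by (simp add: fpd_add fpd_cmult fpd_mult fpd_let fodd_def)
  then have "fconst (1 / fact j) * (fconst (fact j) * (fpd fpsi z * ?p + fpar True z) + fpd fpsi b * ?x) = 0"
    by simp
  then have "fpd fpsi z * ?p + fpar True z + fconst (1 / fact j) * (fpd fpsi b * ?x) = 0"
    by (simp add: distrib_left flip: mult.assoc fconst_mult)
  then have "fpar True z = - fpd fpsi z * ?p + (- fconst (1 / fact j) * fpd fpsi b) * ?x"
    by (simp add: mult.assoc eq_neg_iff_add_eq_0 eq_diff_eq add_ac)
  then have "z = fpar True (- fpd fpsi z * ?p + (- fconst (1 / fact j) * fpd fpsi b) * ?x)"
    by (metis fpar_fpar)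
  also have "\<dots> = (fpar True (- fconst (1 / fact j) * fpd fpsi b)) * ?x + (- fpar True (- fpd fpsi z)) * ?p"
    by (rule par)
  finally show ?thesis by blast
qed

text \<open>Differentiating in \<psi>^+_0 and then setting the variables of index zero to 0 extracts
  \<open>y\<close> up to parity on the left and leaves nothing on the right.\<close>

lemma fshift_zero_of_psip:
  assumes "y * flet fpsip 0 = b * flet fx 0 + c * flet fpsi 0"
  shows "fshift y = 0"
proof -
  have "fshift (fpd fpsip (y * flet fpsip 0)) = fshift (fpd fpsip (b * flet fx 0 + c * flet fpsi 0))"
    using assms by simp
  then have "fpar True (fshift y) = 0"
    by (simp add: fpd_add fpd_mult fpd_let fodd_def fshift_add fshift_mult fshift_fpar)
  then show ?thesis
    by (metis fpar_fpar fpar_zero)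
qed

section \<open>The subalgebra \<open>I\<close> and its cyclic modules\<close>

lemma uconst_simps [simp]: "uconst 0 = 0" "uconst 1 = 1"
  by (simp_all add: uconst.abs_eq zero_uosp_def one_uosp_def tconst_def single_one)

lemma uconst_add: "uconst (a + b) = uconst a + uconst b"
  by (simp add: uconst.abs_eq plus_uosp.abs_eq single_add tconst_def)

lemma uconst_minus: "uconst (- a) = - uconst a"
  by (metis add.right_inverse uconst_add uconst_simps(1) minus_unique)

lemma uconst_mult: "uconst (a * b) = uconst a * uconst b"
  by (simp add: uconst.abs_eq times_uosp.abs_eq mult_single tconst_def)

lemma uconst_of_nat: "uconst (of_nat n) = of_nat n"
  by (induction n) (simp_all add: uconst_add)

lemma uconst_central: "z * uconst c = uconst c * z"
  by transfer (simp add: single_central uideal_def two_sided_ideal.zero tconst_def)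

lemma uconst_two: "uconst 2 = 2"
  using uconst_of_nat[of 2] by simp

lemma uosp_induct [case_names const gen add]:
  assumes c: "\<And>c. P (uconst c)"
    and l: "\<And>y i u. P u \<Longrightarrow> P (ugen y i * u)"
    and a: "\<And>u v. P u \<Longrightarrow> P v \<Longrightarrow> P (u + v)"
  shows "P u"
proof -
  have w: "P (abs_uosp (Poly_Mapping.single (FM xs) c))" for xs c
  proof (induction xs)
    case Nil
    show ?case using c[of c] by (simp add: uconst.abs_eq tconst_def zero_free_monoid_def)
  next
    case (Cons x xs)
    have "Poly_Mapping.single (FM (x # xs)) c = tgen (fst x) (snd x) * Poly_Mapping.single (FM xs) c"
      by (simp add: tgen_def mult_single)
    then show ?case
      using l[OF Cons] by (simp add: ugen.abs_eq times_uosp.abs_eq)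
  qed
  have "P (abs_uosp p)" for p
    by (induction p rule: falg_induct) (simp_all add: w a flip: plus_uosp.abs_eq)
  then show ?thesis by (metis abs_uosp_rep)
qed

lemma ugen_mult:
  "ugen a i * ugen b j = uconst (ssign a b) * ugen b j * ugen a i +
     (\<Sum>k\<in>UNIV. uconst (Poly_Mapping.lookup (osp_br a b) k) * ugen k (i + j))"
proof -
  have "urel a i b j \<in> uideal"
    unfolding uideal_def by (rule two_sided_ideal.gen) blast
  then have "abs_uosp (urel a i b j) = 0"
    by (simp add: zero_uosp_def uosp.abs_eq_iff)
  then show ?thesis
    unfolding urel_def tbr_def UNIV_osp12_basis
    by (simp add: ugen.abs_eq[symmetric] uconst.abs_eq[symmetric] times_uosp.abs_eq[symmetric]
        minus_uosp.abs_eq[symmetric] plus_uosp.abs_eq[symmetric] algebra_simps)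
qed

abbreviation "uE \<equiv> ugen osp_e"
abbreviation "uH \<equiv> ugen osp_h"
abbreviation "uF \<equiv> ugen osp_f"
abbreviation "uGp \<equiv> ugen osp_gp"
abbreviation "uGm \<equiv> ugen osp_gm"

lemma osp_rels:
  "uE i * uF j = uF j * uE i + uH (i + j)"
  "uF i * uE j = uE j * uF i - uH (i + j)"
  "uH i * uE j = uE j * uH i + 2 * uE (i + j)"
  "uH i * uF j = uF j * uH i - 2 * uF (i + j)"
  "uH i * uGp j = uGp j * uH i + uGp (i + j)"
  "uH i * uGm j = uGm j * uH i - uGm (i + j)"
  "uGp i * uGm j = - (uGm j * uGp i) + uH (i + j)"
  "uGp i * uGp j = - (uGp j * uGp i) + 2 * uE (i + j)"
  "uGm i * uGm j = - (uGm j * uGm i) - 2 * uF (i + j)"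
  "uGp i * uF j = uF j * uGp i + uGm (i + j)"
  "uE i * uGm j = uGm j * uE i - uGp (i + j)"
  "uGm i * uE j = uE j * uGm i + uGp (i + j)"
  "uE i * uE j = uE j * uE i"
  "uF i * uF j = uF j * uF i"
  "uH i * uH j = uH j * uH i"
  "uE i * uGp j = uGp j * uE i"
  "uF i * uGm j = uGm j * uF i"
  by (subst ugen_mult; simp add: UNIV_osp12_basis ssign_def lookup_single when_def uconst_minus uconst_two)+

lemma uGm_sq: "uGm 0 * uGm 0 = - uF 0"
proof -
  have "uGm 0 * uGm 0 = - (uGm 0 * uGm 0) - 2 * uF 0"
    using osp_rels(9)[of 0 0] by simp
  then have "uGm 0 * uGm 0 + uGm 0 * uGm 0 = (- (uGm 0 * uGm 0) - 2 * uF 0) + uGm 0 * uGm 0"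
    by simp
  then have "2 * (uGm 0 * uGm 0) = 2 * (- uF 0)"
    by (simp add: mult_2)
  then have "uconst (1/2) * (uconst 2 * (uGm 0 * uGm 0)) = uconst (1/2) * (uconst 2 * (- uF 0))"
    by (simp add: uconst_two)
  then show ?thesis
    by (simp flip: mult.assoc uconst_mult)
qed

lemma commute_power:
  fixes a b :: "'a::ring_1"
  assumes "a * b = b * a"
  shows "a * b ^ k = b ^ k * a"
  by (metis assms power_commuting_commutes)

text \<open>Each of the k + 1 factors \<open>b\<close> that \<open>a\<close> passes contributes one
  \<open>c\<close>, and \<open>c\<close> moves freely among the factors \<open>b\<close>.\<close>

lemma commutator_power1:
  fixes a b c :: "'a::ring_1"
  assumes "a * b = b * a + c" "c * b = b * c"
  shows "a * b ^ Suc k = b ^ Suc k * a + of_nat (Suc k) * (b ^ k * c)"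
proof (induction k)
  case (Suc k)
  have pc: "b ^ k * (b * x) = b * (b ^ k * x)" for x
    by (metis mult.assoc power_commutes)
  have "a * b ^ Suc (Suc k) = (a * b ^ Suc k) * b"
    by (simp only: power_Suc2 mult.assoc)
  also have "\<dots> = b ^ Suc k * (a * b) + of_nat (Suc k) * (b ^ k * (c * b))"
    unfolding Suc by (simp add: distrib_right mult.assoc)
  also have "\<dots> = b ^ Suc (Suc k) * a + of_nat (Suc (Suc k)) * (b ^ Suc k * c)"
    unfolding assms by (simp add: algebra_simps pc)
  finally show ?case .
qed (simp add: assms)

text \<open>Here moving \<open>c\<close> to the right costs \<open>2 * r\<close> for each pair of
  factors \<open>b\<close>, which accounts for the coefficient (k+2)(k+1).\<close>

lemma commutator_power2:
  fixes a b c r :: "'a::ring_1"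
  assumes "a * b = b * a + c" "c * b = b * c + 2 * r" "r * b = b * r"
  shows "a * b ^ Suc (Suc k) = b ^ Suc (Suc k) * a + of_nat (Suc (Suc k)) * (b ^ Suc k * c)
     + of_nat (Suc (Suc k) * Suc k) * (b ^ k * r)"
proof (induction k)
  case 0
  have "a * b ^ Suc (Suc 0) = (a * b) * b"
    by (simp add: mult.assoc)
  also have "\<dots> = b * (a * b) + c * b"
    by (metis assms(1) distrib_right mult.assoc)
  also have "\<dots> = b ^ Suc (Suc 0) * a + of_nat (Suc (Suc 0)) * (b ^ Suc 0 * c)
     + of_nat (Suc (Suc 0) * Suc 0) * (b ^ 0 * r)"
    unfolding assms(1,2) by (simp add: algebra_simps mult_2)
  finally show ?case .
next
  case (Suc k)
  have "a * b ^ Suc (Suc (Suc k)) = (a * b ^ Suc (Suc k)) * b"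
    by (simp only: power_Suc2 mult.assoc)
  also have "\<dots> = b ^ Suc (Suc k) * (a * b) + of_nat (Suc (Suc k)) * (b ^ Suc k * (c * b)) +
      of_nat (Suc (Suc k) * Suc k) * (b ^ k * (r * b))"
    unfolding Suc by (simp only: distrib_right mult.assoc)
  also have "\<dots> = b ^ Suc (Suc (Suc k)) * a + (1 + of_nat (Suc (Suc k))) * (b ^ Suc (Suc k) * c) +
      (2 * of_nat (Suc (Suc k)) + of_nat (Suc (Suc k) * Suc k)) * (b ^ Suc k * r)"
    unfolding assms
    by (simp only: distrib_left distrib_right power_Suc2[of b] mult.assoc mult_1 mult_2 add_ac)
  also have "(1 + of_nat (Suc (Suc k)) :: 'a) = of_nat (Suc (Suc (Suc k)))"
    by simp
  also have "(2 * of_nat (Suc (Suc k)) + of_nat (Suc (Suc k) * Suc k) :: 'a) =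
      of_nat (2 * Suc (Suc k) + Suc (Suc k) * Suc k)"
    by (simp only: of_nat_add of_nat_mult of_nat_numeral)
  also have "2 * Suc (Suc k) + Suc (Suc k) * Suc k = Suc (Suc (Suc k)) * Suc (Suc k)"
    by simp
  finally show ?case .
qed

definition uigens :: "uosp set" where
  "uigens = {ugen y i | y i. 1 \<le> i \<or> y \<in> {osp_f, osp_gm}}"

inductive_set UI :: "uosp set" where
  const: "uconst c \<in> UI"
| gen: "a \<in> uigens \<Longrightarrow> u \<in> UI \<Longrightarrow> a * u \<in> UI"
| add: "u \<in> UI \<Longrightarrow> v \<in> UI \<Longrightarrow> u + v \<in> UI"

lemma UI_mult: "u \<in> UI \<Longrightarrow> v \<in> UI \<Longrightarrow> u * v \<in> UI"
proof (induction rule: UI.induct)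
  case (const c)
  from const show ?case
  proof (induction rule: UI.induct)
    case (const c')
    then show ?case by (simp add: UI.const flip: uconst_mult)
  next
    case (gen a u)
    then show ?case by (metis UI.gen mult.assoc uconst_central)
  qed (simp add: distrib_left UI.add)
qed (simp_all add: distrib_right UI.add UI.gen mult.assoc)

lemma UI_one: "1 \<in> UI"
  using UI.const[of 1] by simp

lemma uigens_UI: "a \<in> uigens \<Longrightarrow> a \<in> UI"
  using UI.gen[OF _ UI_one] by fastforce

lemma UI_ugen [simp]: "1 \<le> i \<Longrightarrow> ugen y i \<in> UI" "uF i \<in> UI" "uGm i \<in> UI"
  by (rule uigens_UI, force simp: uigens_def)+

lemma UI_power [simp]: "u \<in> UI \<Longrightarrow> u ^ k \<in> UI"
  by (induction k) (simp_all add: UI_one UI_mult)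

lemma UI_of_nat [simp]: "of_nat k \<in> UI"
  using UI.const[of "of_nat k"] by (simp add: uconst_of_nat)

text \<open>A left I-submodule of the whole enveloping algebra and not only of I, so that both
  \<open>ui_ideal R\<close> and \<open>weyl_J n\<close> qualify.\<close>

definition ui_submod :: "uosp set \<Rightarrow> bool" where
  "ui_submod L \<longleftrightarrow> 0 \<in> L \<and> (\<forall>x\<in>L. \<forall>y\<in>L. x + y \<in> L) \<and> (\<forall>u\<in>UI. \<forall>x\<in>L. u * x \<in> L)"

inductive_set ui_ideal :: "uosp set \<Rightarrow> uosp set" for R where
  zero: "0 \<in> ui_ideal R"
| gen: "r \<in> R \<Longrightarrow> r \<in> ui_ideal R"
| add: "x \<in> ui_ideal R \<Longrightarrow> y \<in> ui_ideal R \<Longrightarrow> x + y \<in> ui_ideal R"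
| mult: "u \<in> UI \<Longrightarrow> x \<in> ui_ideal R \<Longrightarrow> u * x \<in> ui_ideal R"

lemma ui_submod_ideal: "ui_submod (ui_ideal R)"
  by (simp add: ui_submod_def ui_ideal.zero ui_ideal.add ui_ideal.mult)

text \<open>Right multiplication by \<open>b\<close> is a map of left I-modules, so checking the
  relations \<open>R\<close> is enough: the class of \<open>b\<close> modulo \<open>L\<close>
  generates a quotient of the cyclic module with relations \<open>R\<close>.\<close>

lemma ui_ideal_mult_right:
  assumes "ui_submod L" "\<And>r. r \<in> R \<Longrightarrow> r * b \<in> L" "x \<in> ui_ideal R"
  shows "x * b \<in> L"
  using assms(3)
proof induction
  case (mult u x)
  then show ?case using assms(1) by (simp add: ui_submod_def mult.assoc)
qed (use assms(1,2) in \<open>simp_all add: ui_submod_def distrib_right\<close>)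

lemma ui_ideal_act:
  assumes "\<And>r. r \<in> R \<Longrightarrow> act r z = 0" "x \<in> ui_ideal R"
  shows "act x z = 0"
  using assms(2) by induction (simp_all add: assms(1) act_plus act_mult)

lemma ui_ideal_insert:
  assumes "x \<in> ui_ideal (insert q R)"
  shows "\<exists>k\<in>ui_ideal R. \<exists>u\<in>UI. x = k + u * q"
  using assms
proof induction
  case zero
  show ?case
    using ui_ideal.zero UI.const[of 0] by (metis add_0 mult_zero_left uconst_simps(1))
next
  case (gen r)
  then show ?case
    using ui_ideal.zero[of R] ui_ideal.gen[of r R] UI.const[of 0] UI_one
    by (metis add_0 add.right_neutral insert_iff mult_1 mult_zero_left uconst_simps(1))
next
  case (add x y)
  then obtain k u k' u' where "k \<in> ui_ideal R" "u \<in> UI" "x = k + u * q" "k' \<in> ui_ideal R" "u' \<in> UI" "y = k' + u' * q"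
    by blast
  then have "k + k' \<in> ui_ideal R" "u + u' \<in> UI" "x + y = (k + k') + (u + u') * q"
    by (simp_all add: ui_ideal.add UI.add algebra_simps)
  then show ?case by blast
next
  case (mult v x)
  then obtain k u where "k \<in> ui_ideal R" "u \<in> UI" "x = k + u * q"
    by blast
  with mult(1) have "v * k \<in> ui_ideal R" "v * u \<in> UI" "v * x = v * k + (v * u) * q"
    by (simp_all add: ui_ideal.mult UI_mult algebra_simps)
  then show ?case by blast
qed

context
  fixes L :: "uosp set"
  assumes L: "ui_submod L"
begin

lemma subm_zero: "0 \<in> L"
  and subm_add: "x \<in> L \<Longrightarrow> y \<in> L \<Longrightarrow> x + y \<in> L"
  and subm_mult: "u \<in> UI \<Longrightarrow> x \<in> L \<Longrightarrow> u * x \<in> L"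
  using L by (auto simp: ui_submod_def)

lemma subm_uminus: "x \<in> L \<Longrightarrow> - x \<in> L"
  using subm_mult[OF UI.const[of "-1"]] by (simp add: uconst_minus)

lemma subm_diff: "x \<in> L \<Longrightarrow> y \<in> L \<Longrightarrow> x - y \<in> L"
  using subm_add[of x "- y"] subm_uminus[of y] by simp

lemma subm_uminus_iff: "- x \<in> L \<longleftrightarrow> x \<in> L"
  using subm_uminus by force

lemma subm_add_iff: "y \<in> L \<Longrightarrow> x + y \<in> L \<longleftrightarrow> x \<in> L" "y \<in> L \<Longrightarrow> y + x \<in> L \<longleftrightarrow> x \<in> L"
  using subm_add subm_diff[of "x + y" y] subm_diff[of "y + x" y] by (auto simp: add.commute)

lemma subm_of_nat: "of_nat (Suc k) * x \<in> L \<Longrightarrow> x \<in> L"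
proof -
  assume "of_nat (Suc k) * x \<in> L"
  then have "uconst (1 / of_nat (Suc k)) * (uconst (of_nat (Suc k)) * x) \<in> L"
    unfolding uconst_of_nat by (rule subm_mult[OF UI.const])
  moreover have "uconst (1 / of_nat (Suc k)) * (uconst (of_nat (Suc k)) * x) = x"
    unfolding mult.assoc[symmetric] uconst_mult[symmetric] by (simp del: of_nat_Suc)
  ultimately show ?thesis by simp
qed

lemma subm_two: "2 * x \<in> L \<Longrightarrow> x \<in> L"
  using subm_of_nat[of 1] by simp

end

text \<open>Modulo an \<open>F\<close>-stable \<open>L\<close>, layer \<open>k\<close> consists of
  sums of \<open>k\<close> operators \<open>F j\<close> applied to elements of \<open>S\<close>. The
  indices \<open>j\<close> are arbitrary because commutators shift them.\<close>

inductive layer :: "'a::ring_1 set \<Rightarrow> 'a set \<Rightarrow> (nat \<Rightarrow> 'a) \<Rightarrow> nat \<Rightarrow> 'a \<Rightarrow> bool" for S L F where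
  base: "s \<in> S \<Longrightarrow> layer S L F 0 s"
| sub: "x \<in> L \<Longrightarrow> layer S L F k x"
| add: "layer S L F k x \<Longrightarrow> layer S L F k y \<Longrightarrow> layer S L F k (x + y)"
| uminus: "layer S L F k x \<Longrightarrow> layer S L F k (- x)"
| step: "layer S L F k x \<Longrightarrow> layer S L F (Suc k) (F j * x)"

lemma layer_diff: "layer S L F k x \<Longrightarrow> layer S L F k y \<Longrightarrow> layer S L F k (x - y)"
  using layer.add[of S L F k x "- y"] layer.uminus[of S L F k y] by simp

lemma layer_two: "layer S L F k x \<Longrightarrow> layer S L F k (2 * x)"
  by (simp add: mult_2 layer.add)

text \<open>\<open>H i\<close> preserves the layers and \<open>E i\<close> lowers them by one,
  taking layer 0 into \<open>L\<close>; hence \<open>Suc k\<close> operators \<open>E 0\<close>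
  exhaust layer \<open>k\<close>. The index in \<open>HF\<close> is a successor because
  \<open>H i\<close> stands for h_{i+1} up to sign.\<close>

lemma layer_kill:
  fixes E F H :: "nat \<Rightarrow> 'a::ring_1"
  assumes add: "\<And>x y. x \<in> L \<Longrightarrow> y \<in> L \<Longrightarrow> x + y \<in> L"
    and neg: "\<And>x. x \<in> L \<Longrightarrow> - x \<in> L"
    and EL: "\<And>x i. x \<in> L \<Longrightarrow> E i * x \<in> L"
    and FL: "\<And>x i. x \<in> L \<Longrightarrow> F i * x \<in> L"
    and HL: "\<And>x i. x \<in> L \<Longrightarrow> H i * x \<in> L"
    and EF: "\<And>i j. E i * F j = F j * E i + H (i + j)"
    and HF: "\<And>i j. H i * F j = F j * H i - 2 * F (Suc (i + j))"
    and ES: "\<And>i s. s \<in> S \<Longrightarrow> E i * s \<in> L"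
    and HS: "\<And>i s. s \<in> S \<Longrightarrow> layer S L F 0 (H i * s)"
    and s: "s \<in> S"
  shows "E 0 ^ Suc k * (F 0 ^ k * s) \<in> L"
proof -
  have H: "layer S L F k (H i * x)" if "layer S L F k x" for i k x
    using that
  proof (induction)
    case (step k x j)
    have "H i * (F j * x) = F j * (H i * x) - 2 * (F (Suc (i + j)) * x)"
      by (simp add: HF algebra_simps flip: mult.assoc)
    then show ?case
      using step by (simp add: layer_diff layer_two layer.step)
  qed (simp_all add: HS layer.sub HL distrib_left layer.add layer.uminus)
  have E: "if k = 0 then E i * x \<in> L else layer S L F (k - 1) (E i * x)" if "layer S L F k x" for i k x
    using that
  proof (induction)
    case (step k x j)
    have "E i * (F j * x) = F j * (E i * x) + H (i + j) * x"
      by (simp add: EF algebra_simps flip: mult.assoc)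
    moreover have "layer S L F k (F j * (E i * x))"
      using step by (cases k) (simp_all add: layer.sub FL layer.step)
    ultimately show ?case
      using H[OF step(1)] by (simp add: layer.add)
  qed (auto simp: ES layer.sub EL distrib_left layer.add layer.uminus add neg split: if_splits)
  have F: "layer S L F k (F 0 ^ k * s)" for k
    by (induction k) (simp_all add: layer.base s layer.step mult.assoc)
  have "E 0 ^ Suc k * x \<in> L" if "layer S L F k x" for k x
    using that
  proof (induction k arbitrary: x)
    case 0
    then show ?case using E[of 0 x 0] by simp
  next
    case (Suc k)
    then have "E 0 ^ Suc k * (E 0 * x) \<in> L"
      using E[of "Suc k" x 0] by simp
    then show ?case
      by (simp add: power_Suc2[of _ "Suc k"] mult.assoc del: power_Suc)
  qed
  then show ?thesis using F by blast
qed

text \<open>The relations shared by the kinds of modules generated by products of \<psi>^+;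
  \<open>Bminus\<close> has this role for products of \<psi>.\<close>

definition Bplus :: "uosp set" where
  "Bplus = {ugen y i | y i. y \<in> {osp_e, osp_gp, osp_h} \<and> 1 \<le> i}"

definition Bminus :: "uosp set" where
  "Bminus = {ugen y i | y i. y \<in> {osp_f, osp_gm, osp_h} \<and> (1 \<le> i \<or> y \<noteq> osp_h)}"

text \<open>Commute f_0^{k+1} with g^+_i, h_i and e_i, all in \<open>L\<close>, and divide by the
  integer coefficient. The commutator with e_i shortens the string twice, so the last claim loses
  two powers of f_0.\<close>

lemma F_string:
  assumes L: "ui_submod L" and B: "Bplus \<subseteq> L" and F: "uF 0 ^ Suc k \<in> L" and i: "1 \<le> i"
  shows "uF 0 ^ k * uGm i \<in> L" "uF 0 ^ k * uF i \<in> L" "k = Suc l \<Longrightarrow> uF 0 ^ l * uF i \<in> L"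
proof -
  note subm = subm_add_iff[OF L] subm_uminus_iff[OF L] subm_mult[OF L]
  have BL: "uE i \<in> L" "uGp i \<in> L" "uH i \<in> L"
    using B i by (auto simp: Bplus_def)
  have "uGp i * uF 0 ^ Suc k = uF 0 ^ Suc k * uGp i + of_nat (Suc k) * (uF 0 ^ k * uGm i)"
    by (rule commutator_power1) (simp_all add: osp_rels(10,17))
  moreover have "uGp i * uF 0 ^ Suc k \<in> L" "uF 0 ^ Suc k * uGp i \<in> L"
    using subm_mult[OF L UI_ugen(1)[OF i] F] subm_mult[OF L _ BL(2)] by (simp_all del: power_Suc)
  ultimately show "uF 0 ^ k * uGm i \<in> L"
    by (metis subm(2) subm_of_nat[OF L])
  have "uH i * uF 0 ^ Suc k = uF 0 ^ Suc k * uH i + of_nat (Suc k) * (uF 0 ^ k * (- 2 * uF i))"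
    by (rule commutator_power1) (simp_all add: osp_rels(4,14) mult_2 algebra_simps)
  moreover have "uH i * uF 0 ^ Suc k \<in> L" "uF 0 ^ Suc k * uH i \<in> L"
    using subm_mult[OF L UI_ugen(1)[OF i] F] subm_mult[OF L _ BL(3)] by (simp_all del: power_Suc)
  ultimately have "uF 0 ^ k * (- 2 * uF i) \<in> L"
    by (metis subm(2) subm_of_nat[OF L])
  then show "uF 0 ^ k * uF i \<in> L"
    by (metis mult_2 mult_2_right mult_minus_left mult_minus_right subm(3) subm_two[OF L] distrib_left)
  assume k: "k = Suc l"
  have "uE i * uF 0 ^ Suc k = uF 0 ^ Suc k * uE i + of_nat (Suc k) * (uF 0 ^ k * uH i)
     + of_nat (Suc k * Suc l) * (uF 0 ^ l * (- uF i))"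
    unfolding k by (rule commutator_power2) (simp_all add: osp_rels(1,4) osp_rels(14)[of i])
  moreover have "uE i * uF 0 ^ Suc k \<in> L" "uF 0 ^ Suc k * uE i + of_nat (Suc k) * (uF 0 ^ k * uH i) \<in> L"
    using subm_mult[OF L UI_ugen(1)[OF i] F] subm_mult[OF L _ BL(1)]
      subm_mult[OF L UI_of_nat subm_mult[OF L UI_power[OF UI_ugen(2)] BL(3)]]
    by (simp_all add: subm_add[OF L] del: power_Suc of_nat_Suc)
  ultimately have "of_nat (Suc k * Suc l) * (uF 0 ^ l * (- uF i)) \<in> L"
    by (metis subm(2))
  then have "uF 0 ^ l * (- uF i) \<in> L"
    using subm_of_nat[OF L, of "Suc k * Suc l - 1"] by simp
  then show "uF 0 ^ l * uF i \<in> L"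
    by (simp add: subm)
qed

text \<open>The raising operators start at e_1, which keeps all operators inside I.\<close>

lemma EF_kill:
  assumes L: "ui_submod L" and S: "s \<in> S"
    and ES: "\<And>i s. s \<in> S \<Longrightarrow> uE (Suc i) * s \<in> L"
    and HS: "\<And>i s. s \<in> S \<Longrightarrow> layer S L uF 0 (uH (Suc i) * s)"
  shows "uE 1 ^ Suc k * (uF 0 ^ k * s) \<in> L"
proof -
  have "uE (Suc 0) ^ Suc k * (uF 0 ^ k * s) \<in> L"
    by (rule layer_kill[of L "\<lambda>i. uE (Suc i)" uF "\<lambda>i. uH (Suc i)" S])
      (use assms in \<open>auto simp: osp_rels(1,4) intro: subm_add[OF L] subm_uminus[OF L] subm_mult[OF L]\<close>)
  then show ?thesis by simp
qed

text \<open>\<open>layer_kill\<close> with the roles exchanged: f takes the place of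
  \<open>E\<close>, the e_{j+1} that of \<open>F\<close>, and h changes sign. The base layer already
  contains one e_1, so e_1^{k+1} lies in layer k.\<close>

lemma FE_kill:
  assumes L: "ui_submod L" and B: "Bminus \<subseteq> L"
  shows "uF 0 ^ Suc k * uE 1 ^ Suc k \<in> L"
proof -
  define S where "S = range (\<lambda>j. uE (Suc j))"
  have BL: "uF i \<in> L" "uH (Suc i) \<in> L" for i
    using B by (force simp: Bminus_def)+
  have s: "uE (Suc j) \<in> S" for j
    by (simp add: S_def)
  have "uF i * uE (Suc j) \<in> L" for i j
    unfolding osp_rels(2) using BL subm_diff[OF L] subm_mult[OF L] by simp
  moreover have "layer S L (\<lambda>j. uE (Suc j)) 0 (- uH (Suc i) * uE (Suc j))" for i j
  proof -
    have "- uH (Suc i) * uE (Suc j) = - (uE (Suc j) * uH (Suc i)) - 2 * uE (Suc (Suc (i + j)))"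
      by (simp add: osp_rels(3))
    moreover have "uE (Suc j) * uH (Suc i) \<in> L"
      by (simp add: subm_mult[OF L] BL)
    ultimately show ?thesis
      by (simp only:) (intro layer_diff layer.uminus layer_two layer.sub layer.base s)
  qed
  ultimately have "uF 0 ^ Suc k * (uE (Suc 0) ^ k * uE (Suc 0)) \<in> L"
    by (intro layer_kill[of L uF "\<lambda>j. uE (Suc j)" "\<lambda>j. - uH (Suc j)" S])
      (auto simp: osp_rels(2,3) S_def algebra_simps subm_uminus_iff[OF L]
        intro: subm_add[OF L] subm_uminus[OF L] subm_mult[OF L])
  then show ?thesis
    by (simp add: power_Suc2[of "uE _"] del: power_Suc)
qed

section \<open>Extremal vectors: maps between the three kinds of cyclic modules\<close>

lemma uF_uGm_power: "uGm i * uF 0 ^ k = uF 0 ^ k * uGm i" "uF i * uF 0 ^ k = uF 0 ^ k * uF i"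
  by (simp_all add: commute_power osp_rels(14,17))

text \<open>In the module with f_0^{k+1} g^-_0 = 0, the vector f_0^{k+1} thus generates a quotient
  of the module with e_1^{k+1} = 0.\<close>

lemma plus_to_minus_even:
  assumes L: "ui_submod L" and B: "Bplus \<subseteq> L" and F: "uF 0 ^ Suc k * uGm 0 \<in> L"
    and r: "r \<in> insert (uE 1 ^ Suc k) Bminus"
  shows "r * uF 0 ^ Suc k \<in> L"
proof -
  note subm = subm_add[OF L] subm_diff[OF L] subm_mult[OF L] subm_uminus[OF L]
  have BL: "uE i \<in> L" "uGp i \<in> L" "uH i \<in> L" if "1 \<le> i" for i
    using B that by (auto simp: Bplus_def)
  \<comment> \<open>As (g^-_0)^2 = -f_0, the pure f-string also ends, one step later, which makes
    \<open>F_string\<close> available.\<close>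
  have "uGm 0 * (uF 0 ^ Suc k * uGm 0) \<in> L"
    by (intro subm F UI_ugen)
  also have "uGm 0 * (uF 0 ^ Suc k * uGm 0) = - (uF 0 ^ Suc (Suc k))"
    by (simp only: mult.assoc[symmetric] uF_uGm_power) (simp only: mult.assoc uGm_sq mult_minus_right power_Suc2)
  finally have F2: "uF 0 ^ Suc (Suc k) \<in> L"
    by (simp only: subm_uminus_iff[OF L])
  note str = F_string[OF L B F2]
  show ?thesis
  proof (cases "r = uE 1 ^ Suc k")
    case True
    \<comment> \<open>One f_0 is counted as an element of the base layer of all f_j, so k + 1
      factors e_1 are enough.\<close>
    have "uE 1 ^ Suc k * (uF 0 ^ k * uF 0) \<in> L"
    proof (rule EF_kill[OF L, of _ "range uF"])
      fix i s
      assume "s \<in> range uF"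
      then obtain j where s: "s = uF j" by blast
      show "uE (Suc i) * s \<in> L"
        unfolding s osp_rels(1) by (intro subm BL UI_ugen) simp_all
      show "layer (range uF) L uF 0 (uH (Suc i) * s)"
        unfolding s osp_rels(4) by (intro layer_diff layer_two layer.base layer.sub subm BL UI_ugen) simp_all
    qed simp
    then show ?thesis by (simp only: True power_Suc2)
  next
    case False
    with r obtain y i where y: "r = ugen y i" "y \<in> {osp_f, osp_gm, osp_h}" "1 \<le> i \<or> y \<noteq> osp_h"
      by (auto simp: Bminus_def)
    consider "r = uF 0" | "r = uGm 0" | "r = uF i" "1 \<le> i" | "r = uGm i" "1 \<le> i" | "r = uH i" "1 \<le> i"
      using y by (cases "i = 0") auto
    then show ?thesis
    proof cases
      case 1
      with F2 show ?thesis by simp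
    next
      case 2
      with F show ?thesis by (simp only: uF_uGm_power)
    next
      case 3
      with str(2) show ?thesis by (simp only: uF_uGm_power)
    next
      case 4
      with str(1) show ?thesis by (simp only: uF_uGm_power)
    next
      case 5
      have "uH i * uF 0 ^ Suc k = uF 0 ^ Suc k * uH i + of_nat (Suc k) * (uF 0 ^ k * (- 2 * uF i))"
        by (rule commutator_power1) (simp_all add: osp_rels(4,14) mult_2 algebra_simps)
      also have "uF 0 ^ k * (- 2 * uF i) = - (uF 0 ^ k * uF i) - uF 0 ^ k * uF i"
        by (simp add: mult_2 algebra_simps)
      also have "uF 0 ^ Suc k * uH i + of_nat (Suc k) * (- (uF 0 ^ k * uF i) - uF 0 ^ k * uF i) \<in> L"
        using 5 by (intro subm BL str(3) UI_of_nat UI_power UI_ugen) simp_all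
      finally show ?thesis
        using 5 by simp
    qed
  qed
qed

text \<open>The counterpart when f_0^{k+1} = 0: now f_0^k g^-_0 is the last vector of the string,
  and it satisfies the same relations.\<close>

lemma plus_to_minus_odd:
  assumes L: "ui_submod L" and B: "Bplus \<subseteq> L" and F: "uF 0 ^ Suc k \<in> L"
    and r: "r \<in> insert (uE 1 ^ Suc k) Bminus"
  shows "r * (uF 0 ^ k * uGm 0) \<in> L"
proof -
  note subm = subm_add[OF L] subm_diff[OF L] subm_mult[OF L] subm_uminus[OF L]
  have BL: "uE i \<in> L" "uGp i \<in> L" "uH i \<in> L" if "1 \<le> i" for i
    using B that by (auto simp: Bplus_def)
  note str = F_string[OF L B F]
  have FG: "uF 0 ^ k * uGm 0 = uGm 0 * uF 0 ^ k"
    by (simp only: uF_uGm_power)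
  show ?thesis
  proof (cases "r = uE 1 ^ Suc k")
    case True
    \<comment> \<open>The base layer consists of all g^-_j, since brackets with h stay among
      them.\<close>
    have "uE 1 ^ Suc k * (uF 0 ^ k * uGm 0) \<in> L"
    proof (rule EF_kill[OF L, of _ "range uGm"])
      fix i s
      assume "s \<in> range uGm"
      then obtain j where s: "s = uGm j" by blast
      show "uE (Suc i) * s \<in> L"
        unfolding s osp_rels(11) by (intro subm BL UI_ugen) simp_all
      show "layer (range uGm) L uF 0 (uH (Suc i) * s)"
        unfolding s osp_rels(6) by (intro layer_diff layer.base layer.sub subm BL UI_ugen) simp_all
    qed simp
    then show ?thesis by (simp only: True)
  next
    case False
    with r obtain y i where y: "r = ugen y i" "y \<in> {osp_f, osp_gm, osp_h}" "1 \<le> i \<or> y \<noteq> osp_h"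
      by (auto simp: Bminus_def)
    consider "r = uF 0" | "r = uGm 0" | "r = uF i" "1 \<le> i" | "r = uGm i" "1 \<le> i" | "r = uH i" "1 \<le> i"
      using y by (cases "i = 0") auto
    then show ?thesis
    proof cases
      case 1
      have "uF 0 * (uF 0 ^ k * uGm 0) = uGm 0 * uF 0 ^ Suc k"
        by (simp only: uF_uGm_power(1) power_Suc[symmetric] mult.assoc[symmetric])
      with 1 show ?thesis using subm(3)[OF UI_ugen(3) F] by metis
    next
      case 2
      have "uGm 0 * (uF 0 ^ k * uGm 0) = - (uF 0 ^ Suc k)"
        by (simp only: mult.assoc[symmetric] uF_uGm_power) (simp only: mult.assoc uGm_sq mult_minus_right power_Suc2)
      with 2 show ?thesis using subm(4)[OF F] by metis
    next
      case 3
      have "uF i * (uF 0 ^ k * uGm 0) = uGm 0 * (uF 0 ^ k * uF i)"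
        by (metis FG mult.assoc osp_rels(17) uF_uGm_power(2))
      then show ?thesis using 3 subm(3)[OF UI_ugen(3) str(2)] by metis
    next
      case 4
      have "uGm i * (uF 0 ^ k * uGm 0) = uF 0 ^ k * (uGm i * uGm 0)"
        by (metis mult.assoc uF_uGm_power(1))
      also have "\<dots> = - (uF 0 ^ k * uGm 0 * uGm i) - (uF 0 ^ k * uF i + uF 0 ^ k * uF i)"
        by (simp add: osp_rels(9)[of i 0] mult_2 algebra_simps)
      also have "\<dots> = - (uGm 0 * (uF 0 ^ k * uGm i)) - (uF 0 ^ k * uF i + uF 0 ^ k * uF i)"
        by (simp only: FG mult.assoc)
      also have "\<dots> \<in> L"
        using 4 by (intro subm str(1,2) UI_ugen) simp_all
      finally show ?thesis using 4 by simp
    next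
      case 5
      have "uF 0 ^ k * uH i * uGm 0 \<in> L"
        using 5 by (simp add: mult.assoc osp_rels(6)) (simp add: right_diff_distrib subm str(1) BL)
      moreover have "uH i * uF 0 ^ k * uGm 0 - uF 0 ^ k * uH i * uGm 0 \<in> L"
      \<comment> \<open>For k = 0 the difference is zero; otherwise it involves f_0^{k-1} f_i, which
        is covered by the last claim of \<open>F_string\<close>.\<close>
      proof (cases k)
        case (Suc l)
        have "uH i * uF 0 ^ Suc l = uF 0 ^ Suc l * uH i + of_nat (Suc l) * (uF 0 ^ l * (- 2 * uF i))"
          by (rule commutator_power1) (simp_all add: osp_rels(4,14) mult_2 algebra_simps)
        then have "uH i * uF 0 ^ k * uGm 0 - uF 0 ^ k * uH i * uGm 0 =
            of_nat (Suc l) * (uF 0 ^ l * (- 2 * uF i)) * uGm 0"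
          by (simp add: Suc distrib_right left_diff_distrib del: power_Suc of_nat_Suc)
        also have "\<dots> = of_nat (Suc l) * (- (uF 0 ^ l * (uF i * uGm 0)) - uF 0 ^ l * (uF i * uGm 0))"
          by (simp add: mult_2 algebra_simps del: of_nat_Suc)
        also have "uF 0 ^ l * (uF i * uGm 0) = uGm 0 * (uF 0 ^ l * uF i)"
          by (metis mult.assoc osp_rels(17) uF_uGm_power(1))
        also have "of_nat (Suc l) * (- (uGm 0 * (uF 0 ^ l * uF i)) - uGm 0 * (uF 0 ^ l * uF i)) \<in> L"
          using 5 Suc by (intro subm str(3) UI_of_nat UI_ugen) simp_all
        finally show ?thesis .
      qed (simp add: subm_zero[OF L])
      ultimately show ?thesis
        using 5 subm(1) by (fastforce simp: mult.assoc)
    qed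
  qed
qed

text \<open>The extremal vector \<open>e\<^sub>s\<^sup>m w\<close> of the string through \<open>w\<close>, used for \<open>s = 0\<close> and \<open>s = 1\<close>.\<close>

lemma E_string:
  assumes L: "ui_submod L" and EL: "\<And>x. x \<in> L \<Longrightarrow> uE s * x \<in> L"
    and low: "\<And>j. 1 \<le> j + s \<Longrightarrow> uF j \<in> L \<and> uGm j \<in> L" "\<And>j. 1 \<le> j \<Longrightarrow> uH j \<in> L"
    and E: "uE s ^ Suc m \<in> L" and s: "s \<le> 1" and r: "r \<in> Bplus"
  shows "r * uE s ^ m \<in> L"
proof -
  note subm = subm_add[OF L] subm_diff[OF L] subm_mult[OF L] subm_uminus[OF L]
  have EkL: "uE s ^ k * x \<in> L" if "x \<in> L" for k x
    by (induction k) (simp_all add: that EL mult.assoc)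
  have HE: "uH j * uE s ^ Suc k = uE s ^ Suc k * uH j + of_nat (Suc k) * (uE s ^ k * (2 * uE (j + s)))" for j k
    by (rule commutator_power1) (simp_all add: osp_rels(3,13) mult_2 algebra_simps)
  have cancel: "x \<in> L" if "y = z + of_nat (Suc k) * x" "y \<in> L" "z \<in> L" for x y z k
    using that by (metis subm_add_iff(2)[OF L] subm_of_nat[OF L])
  obtain i where i: "1 \<le> i" and "r = uE i \<or> r = uGp i \<or> r = uH i"
    using r by (auto simp: Bplus_def)
  \<comment> \<open>The nontrivial cases commute h_{i-s}, g^-_{i-s} or f_{i-s} with e_s^{m+1}; s
    \<le> 1 \<le> i makes i - s a true difference. For h_i with m > 0 two successive brackets are
    used.\<close>
  then consider "r = uE i" "i = s" | "r = uE i" "i > s" | "r = uGp i" | "r = uH i" "m = 0" | l where "r = uH i" "m = Suc l"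
    using s by (cases m) fastforce+
  then show ?thesis
  proof cases
    case 1
    with E show ?thesis by simp
  next
    case 2
    have "uE s ^ m * (2 * uE (i - s + s)) \<in> L"
      by (rule cancel[OF HE]) (use 2 in \<open>intro subm E EkL low; simp\<close>)+
    with 2 have "2 * (uE s ^ m * uE i) \<in> L"
      by (simp add: mult_2 distrib_left)
    then have "uE s ^ m * uE i \<in> L"
      by (rule subm_two[OF L])
    with 2 show ?thesis
      by (simp add: commute_power osp_rels(13))
  next
    case 3
    have "uGm (i - s) * uE s ^ Suc m = uE s ^ Suc m * uGm (i - s) + of_nat (Suc m) * (uE s ^ m * uGp i)"
      using i s by (intro commutator_power1) (simp_all add: osp_rels(12,16))
    then have "uE s ^ m * uGp i \<in> L"
      by (rule cancel) (use i in \<open>intro subm E EkL low(1)[THEN conjunct2]; simp\<close>)+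
    with 3 show ?thesis
      by (simp add: commute_power osp_rels(16))
  next
    case 4
    with i show ?thesis by (simp add: low)
  next
    case 5
    have "uF (i - s) * uE s ^ Suc (Suc l) = uE s ^ Suc (Suc l) * uF (i - s) + of_nat (Suc (Suc l)) * (uE s ^ Suc l * (- uH i))
       + of_nat (Suc (Suc l) * Suc l) * (uE s ^ l * (- uE (i + s)))"
      using i s by (intro commutator_power2) (simp_all add: osp_rels(2,3) osp_rels(13)[of "i + s"])
    \<comment> \<open>Written as a successor so that \<open>cancel\<close> applies.\<close>
    also have "of_nat (Suc (Suc l) * Suc l) = (of_nat (Suc (Suc (Suc l) * Suc l - 1)) :: uosp)"
      by simp
    finally have "uE s ^ l * (- uE (i + s)) \<in> L"
      by (rule cancel) (use i 5 E in \<open>(intro subm E EkL low(1)[THEN conjunct1] low(2) UI_of_nat; simp)+\<close>)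
    then have "uE s ^ l * uE (i + s) \<in> L"
      by (simp add: subm_uminus_iff[OF L])
    then have "uE s ^ Suc l * uH i + of_nat (Suc l) * (uE s ^ l * uE (i + s) + uE s ^ l * uE (i + s)) \<in> L"
      using i by (intro subm(1) subm(3)[OF UI_of_nat] EkL[of "uH i"] low \<open>uE s ^ l * uE (i + s) \<in> L\<close>)
    then show ?thesis
      unfolding 5 HE by (simp only: mult_2 distrib_left)
  qed
qed

text \<open>The raising relations come from \<open>E_string\<close> with s = 1, the relation
  f_0^{k+1} from \<open>FE_kill\<close>. So e_1^{k+1} generates a quotient of the module with
  f_0^{k+1} = 0.\<close>

lemma minus_to_plus:
  assumes L: "ui_submod L" and B: "Bminus \<subseteq> L" and E: "uE 1 ^ Suc (Suc k) \<in> L"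
    and r: "r \<in> insert (uF 0 ^ Suc k) Bplus"
  shows "r * uE 1 ^ Suc k \<in> L"
proof (cases "r = uF 0 ^ Suc k")
  case True
  then show ?thesis using FE_kill[OF L B] by simp
next
  case False
  have "uF j \<in> L \<and> uGm j \<in> L" "1 \<le> j \<Longrightarrow> uH j \<in> L" for j
    using B by (force simp: Bminus_def)+
  then show ?thesis
    using False r E subm_mult[OF L] by (intro E_string[OF L]) auto
qed

section \<open>Weyl modules over \<open>I\<close>\<close>

lemma weyl_J_closed: "x \<in> weyl_J n \<Longrightarrow> u * x \<in> weyl_J n" "x \<in> weyl_J n \<Longrightarrow> y \<in> weyl_J n \<Longrightarrow> x + y \<in> weyl_J n"
  by (simp_all add: weyl_J_def left_ideal.mult_left left_ideal.add)

lemma weyl_J_submod: "ui_submod (weyl_J n)"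
  by (simp add: ui_submod_def weyl_J_closed) (simp add: weyl_J_def left_ideal.zero)

lemma weyl_J_rels:
  "uF i \<in> weyl_J n" "uGm i \<in> weyl_J n" "1 \<le> i \<Longrightarrow> uH i \<in> weyl_J n"
  "uH 0 + of_nat n \<in> weyl_J n" "uE 0 ^ Suc n \<in> weyl_J n"
proof -
  have *: "r \<in> weyl_J n" if "r \<in> weyl_rels n" for r
    using that by (simp add: weyl_J_def left_ideal.gen)
  show "uF i \<in> weyl_J n" "uGm i \<in> weyl_J n"
    by (rule *, cases "i = 0"; force simp: weyl_rels_def)+
  show "1 \<le> i \<Longrightarrow> uH i \<in> weyl_J n"
    by (rule *) (force simp: weyl_rels_def)
  have "uH 0 - uconst (- of_nat n) \<in> weyl_J n" "uE 0 ^ (n + 1) \<in> weyl_J n"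
    by (rule *, simp add: weyl_rels_def)+
  then show "uH 0 + of_nat n \<in> weyl_J n" "uE 0 ^ Suc n \<in> weyl_J n"
    by (simp_all add: uconst_minus uconst_of_nat)
qed

lemma weyl_FE:
  "\<exists>c. (k < n \<longrightarrow> c \<noteq> 0) \<and> uF 0 * uE 0 ^ Suc k - uconst c * uE 0 ^ k \<in> weyl_J n"
proof -
  let ?J = "weyl_J n"
  note subm = subm_add[OF weyl_J_submod] subm_diff[OF weyl_J_submod] weyl_J_closed(1)
  \<comment> \<open>The sl_2 coefficient of f_0 e_0^{k+1} on a vector of lowest weight -n.\<close>
  let ?c = "of_nat (Suc k) * (of_nat n - of_nat k) :: complex"
  have "uF 0 * uE 0 ^ Suc k - uconst ?c * uE 0 ^ k \<in> ?J"
  proof (cases k)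
    case 0
    have "uF 0 * uE 0 - of_nat n = uE 0 * uF 0 - (uH 0 + of_nat n)"
      by (simp add: osp_rels(2))
    also have "\<dots> \<in> ?J"
      by (intro subm weyl_J_rels)
    finally show ?thesis
      by (simp add: 0 uconst_of_nat)
  next
    case (Suc l)
    have "uF 0 * uE 0 ^ Suc (Suc l) = uE 0 ^ Suc (Suc l) * uF 0 + of_nat (Suc (Suc l)) * (uE 0 ^ Suc l * (- uH 0))
       + of_nat (Suc (Suc l) * Suc l) * (uE 0 ^ l * (- uE 0))"
      by (intro commutator_power2) (simp_all add: osp_rels(2,3))
    moreover have "uconst ?c * uE 0 ^ k = of_nat (Suc (Suc l)) * (uE 0 ^ Suc l * of_nat n)
       - of_nat (Suc (Suc l) * Suc l) * (uE 0 ^ l * uE 0)"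
    proof -
      have "uE 0 ^ Suc l * of_nat n = uconst (of_nat n) * uE 0 ^ Suc l"
        by (metis uconst_of_nat uconst_central)
      moreover have "of_nat (Suc (Suc l) * Suc l) = uconst (of_nat (Suc (Suc l) * Suc l))"
        "of_nat (Suc (Suc l)) = uconst (of_nat (Suc (Suc l)))"
        by (simp_all only: uconst_of_nat)
      moreover have "?c = of_nat (Suc (Suc l)) * of_nat n - of_nat (Suc (Suc l) * Suc l)"
        by (simp add: Suc algebra_simps)
      ultimately show ?thesis
        using uconst_add[of "of_nat (Suc (Suc l)) * of_nat n" "- of_nat (Suc (Suc l) * Suc l)"]
        by (simp only: Suc power_Suc2 mult.assoc uconst_mult uconst_minus left_diff_distrib
            diff_conv_add_uminus) (simp add: mult.assoc distrib_right left_diff_distrib)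
    qed
    ultimately have "uF 0 * uE 0 ^ Suc k - uconst ?c * uE 0 ^ k =
        uE 0 ^ Suc (Suc l) * uF 0 - of_nat (Suc (Suc l)) * (uE 0 ^ Suc l * (uH 0 + of_nat n))"
      by (simp add: Suc distrib_left del: power_Suc of_nat_Suc)
    also have "\<dots> \<in> ?J"
      by (intro subm weyl_J_rels)
    finally show ?thesis .
  qed
  moreover have "k < n \<Longrightarrow> ?c \<noteq> 0"
    by (simp del: of_nat_Suc)
  ultimately show ?thesis by blast
qed

text \<open>Descending the sl_2-string recovers the generator up to the product of the nonzero
  scalars of \<open>weyl_FE\<close>.\<close>

lemma weyl_FkEk: "k \<le> n \<Longrightarrow> \<exists>c. c \<noteq> 0 \<and> uF 0 ^ k * uE 0 ^ k - uconst c \<in> weyl_J n"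
proof (induction k)
  case 0
  have "uF 0 ^ 0 * uE 0 ^ 0 - uconst 1 \<in> weyl_J n"
    by (simp add: subm_zero[OF weyl_J_submod])
  then show ?case by (metis zero_neq_one)
next
  case (Suc k)
  then obtain c where c: "c \<noteq> 0" "uF 0 ^ k * uE 0 ^ k - uconst c \<in> weyl_J n"
    by auto
  obtain d where d: "d \<noteq> 0" "uF 0 * uE 0 ^ Suc k - uconst d * uE 0 ^ k \<in> weyl_J n"
    using weyl_FE[of k n] Suc.prems by auto
  have "uF 0 ^ Suc k * uE 0 ^ Suc k - uconst (d * c) =
    uF 0 ^ k * (uF 0 * uE 0 ^ Suc k - uconst d * uE 0 ^ k) + uconst d * (uF 0 ^ k * uE 0 ^ k - uconst c)"
    by (simp add: power_Suc2[of "uF 0"] right_diff_distrib mult.assoc uconst_mult del: power_Suc)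
      (metis mult.assoc uconst_central)
  also have "\<dots> \<in> weyl_J n"
    using c d by (intro weyl_J_closed)
  finally show ?case
    using c d by (metis mult_eq_0_iff)
qed

text \<open>For the top vector e_0^n w the raising relations are \<open>E_string\<close> with s = 0,
  and f_0^n returns it to a multiple of w, which g^-_0 kills.\<close>

lemma zero_to_plus:
  assumes r: "r \<in> insert (uF 0 ^ n * uGm 0) Bplus"
  shows "r * uE 0 ^ n \<in> weyl_J n"
proof (cases "r \<in> Bplus")
  case True
  then show ?thesis
    by (intro E_string[OF weyl_J_submod]) (simp_all add: weyl_J_closed weyl_J_rels del: power_Suc)
next
  case False
  obtain c where c: "uF 0 ^ n * uE 0 ^ n - uconst c \<in> weyl_J n"
    using weyl_FkEk[of n n] by auto
  have "r * uE 0 ^ n = uGm 0 * (uF 0 ^ n * uE 0 ^ n - uconst c) + uconst c * uGm 0"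
    using False r by (simp add: right_diff_distrib uconst_central flip: uF_uGm_power(1) mult.assoc)
  also have "\<dots> \<in> weyl_J n"
    by (intro weyl_J_closed c weyl_J_rels)
  finally show ?thesis .
qed

text \<open>These are the generators of index zero outside I; each acts on the top vector by a
  scalar.\<close>

lemma weyl_top_raise: "uE 0 * uE 0 ^ n \<in> weyl_J n" "uGp 0 * uE 0 ^ n \<in> weyl_J n"
    "uH 0 * uE 0 ^ n - of_nat n * uE 0 ^ n \<in> weyl_J n"
proof -
  let ?J = "weyl_J n"
  note subm = subm_add[OF weyl_J_submod] subm_diff[OF weyl_J_submod] weyl_J_closed(1)
  show "uE 0 * uE 0 ^ n \<in> ?J"
    using weyl_J_rels(5) by simp
  have "uGm 0 * uE 0 ^ Suc n = uE 0 ^ Suc n * uGm 0 + of_nat (Suc n) * (uE 0 ^ n * uGp 0)"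
    by (intro commutator_power1) (simp_all add: osp_rels(12,16))
  moreover have "uGm 0 * uE 0 ^ Suc n \<in> ?J" "uE 0 ^ Suc n * uGm 0 \<in> ?J"
    by (intro subm weyl_J_rels)+
  ultimately have "uE 0 ^ n * uGp 0 \<in> ?J"
    by (metis subm_add_iff(2)[OF weyl_J_submod] subm_of_nat[OF weyl_J_submod])
  then show "uGp 0 * uE 0 ^ n \<in> ?J"
    by (simp add: commute_power osp_rels(16))
  have H: "uH 0 * uE 0 ^ k = uE 0 ^ k * (uH 0 + 2 * of_nat k)" for k
  proof (induction k)
    case (Suc k)
    have "uH 0 * uE 0 ^ Suc k = (uH 0 * uE 0) * uE 0 ^ k"
      by (simp add: mult.assoc)
    also have "\<dots> = uE 0 * (uH 0 * uE 0 ^ k) + (uE 0 ^ Suc k + uE 0 ^ Suc k)"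
      by (simp add: osp_rels(3) distrib_right mult.assoc mult_2)
    finally show ?case
      unfolding Suc by (simp add: distrib_left mult.assoc mult_2 mult_2_right)
  qed simp
  have "uH 0 * uE 0 ^ n - of_nat n * uE 0 ^ n = uE 0 ^ n * (uH 0 + 2 * of_nat n) - uE 0 ^ n * of_nat n"
    unfolding H by (simp only: mult_of_nat_commute)
  also have "\<dots> = uE 0 ^ n * (uH 0 + of_nat n)"
    by (simp add: distrib_left mult_2)
  also have "\<dots> \<in> ?J"
    by (intro subm weyl_J_rels)
  finally show "uH 0 * uE 0 ^ n - of_nat n * uE 0 ^ n \<in> ?J" .
qed

text \<open>A generator is moved to the right through the word \<open>v\<close> until it meets the
  top vector; there \<open>weyl_top_raise\<close> handles those outside I.\<close>

lemma weyl_UI_gen: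
  assumes "v \<in> UI"
  shows "\<exists>u\<in>UI. (ugen y i * v - u) * uE 0 ^ n \<in> weyl_J n"
proof -
  let ?J = "weyl_J n"
  let ?P = "\<lambda>x. \<exists>u\<in>UI. (x - u) * uE 0 ^ n \<in> ?J"
  note subm = subm_add[OF weyl_J_submod] subm_diff[OF weyl_J_submod] weyl_J_closed(1)
  have P_UI: "?P u" if "u \<in> UI" for u
    using that by (auto intro!: bexI[of _ u] simp: subm_zero[OF weyl_J_submod])
  have P_add: "?P (x + x')" if "?P x" "?P x'" for x x'
  proof -
    obtain u u' where "u \<in> UI" "u' \<in> UI" "(x - u) * uE 0 ^ n \<in> ?J" "(x' - u') * uE 0 ^ n \<in> ?J"
      using \<open>?P x\<close> \<open>?P x'\<close> by blast
    then have "u + u' \<in> UI" "(x + x' - (u + u')) * uE 0 ^ n \<in> ?J"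
      using subm(1)[of "(x - u) * uE 0 ^ n" n "(x' - u') * uE 0 ^ n"]
      by (simp_all add: UI.add flip: distrib_right) (simp add: algebra_simps)
    then show ?thesis by blast
  qed
  have P_mult: "?P (a * x)" if "a \<in> UI" and x: "?P x" for a x
  proof -
    obtain u where "u \<in> UI" "(x - u) * uE 0 ^ n \<in> ?J"
      using x by blast
    then have "a * u \<in> UI" "(a * x - a * u) * uE 0 ^ n \<in> ?J"
      using that weyl_J_closed(1)[of "(x - u) * uE 0 ^ n" n a]
      by (simp_all add: UI_mult right_diff_distrib mult.assoc left_diff_distrib)
    then show ?thesis by blast
  qed
  have P_sum: "?P (sum f A)" if "\<And>k. ?P (f k)" for f :: "osp12_basis \<Rightarrow> uosp" and A
    by (induction A rule: infinite_finite_induct) (use P_UI[OF UI.const[of 0]] that in \<open>simp_all add: P_add\<close>)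
  \<comment> \<open>All generators are treated at once because each bracket replaces y_i by
    others.\<close>
  from assms have "\<forall>y i. ?P (ugen y i * v)"
  proof induction
    case (const c)
    have "?P (ugen y i)" for y i
    proof (cases "1 \<le> i \<or> y \<in> {osp_f, osp_gm}")
      case True
      then show ?thesis by (auto intro: P_UI simp: uigens_def uigens_UI)
    next
      case False
      then have "i = 0" by simp
      with False have "ugen y i = uE 0 \<or> ugen y i = uGp 0 \<or> ugen y i = uH 0"
        by (cases y) auto
      moreover have "?P (uE 0)" "?P (uGp 0)"
        using weyl_top_raise[of n] UI.const[of 0] by (auto intro!: bexI[of _ 0])
      moreover have "?P (uH 0)"
        using weyl_top_raise(3)[of n] by (auto intro!: bexI[of _ "of_nat n"] simp: left_diff_distrib)
      ultimately show ?thesis by metis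
    qed
    from P_mult[OF UI.const this] show ?case
      by (metis uconst_central)
  next
    case (gen a v)
    then obtain z j where a: "a = ugen z j"
      by (auto simp: uigens_def)
    show ?case
    proof (intro allI)
      fix y i
      have "ugen y i * (a * v) = uconst (ssign y z) * (a * (ugen y i * v)) +
         (\<Sum>k\<in>UNIV. uconst (Poly_Mapping.lookup (osp_br y z) k) * (ugen k (i + j) * v))"
        unfolding mult.assoc[symmetric] a ugen_mult[of y i z j]
        by (simp add: distrib_right mult.assoc sum_distrib_right)
      moreover have "?P (uconst (ssign y z) * (a * (ugen y i * v)))"
        using gen by (intro P_mult[OF UI.const P_mult[OF uigens_UI]]) auto
      moreover have "?P (\<Sum>k\<in>UNIV. uconst (Poly_Mapping.lookup (osp_br y z) k) * (ugen k (i + j) * v))"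
        using gen by (intro P_sum P_mult[OF UI.const]) auto
      ultimately show "?P (ugen y i * (a * v))"
        using P_add by presburger
    qed
  next
    case (add u v)
    then show ?case
      using P_add by (simp add: distrib_left)
  qed
  then show ?thesis by blast
qed

text \<open>By \<open>weyl_UI_gen\<close> the I-span of the top vector is stable under the whole
  algebra, and it contains the generator, a nonzero multiple of f_0^n e_0^n w.\<close>

lemma weyl_generated_by_top: "\<exists>v\<in>UI. u - v * uE 0 ^ n \<in> weyl_J n"
proof -
  let ?J = "weyl_J n"
  note subm = subm_add[OF weyl_J_submod] subm_diff[OF weyl_J_submod] weyl_J_closed(1)
  have P: "\<exists>v\<in>UI. (x - v) * uE 0 ^ n \<in> ?J" for x
  proof (induction x rule: uosp_induct)
    case (const c)
    show ?case
      by (rule bexI[OF _ UI.const[of c]]) (simp add: subm_zero[OF weyl_J_submod])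
  next
    case (gen y i x)
    then obtain v where v: "v \<in> UI" "(x - v) * uE 0 ^ n \<in> ?J"
      by blast
    obtain v' where v': "v' \<in> UI" "(ugen y i * v - v') * uE 0 ^ n \<in> ?J"
      using weyl_UI_gen[OF v(1)] by blast
    have "(ugen y i * x - v') * uE 0 ^ n = ugen y i * ((x - v) * uE 0 ^ n) + (ugen y i * v - v') * uE 0 ^ n"
      by (simp add: left_diff_distrib right_diff_distrib mult.assoc)
    also have "\<dots> \<in> ?J"
      by (intro subm v v')
    finally show ?case using v' by blast
  next
    case (add x y)
    then obtain v v' where "v \<in> UI" "v' \<in> UI" "(x - v) * uE 0 ^ n \<in> ?J" "(y - v') * uE 0 ^ n \<in> ?J"
      by blast
    then have "v + v' \<in> UI" "(x + y - (v + v')) * uE 0 ^ n \<in> ?J"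
      using subm(1)[of "(x - v) * uE 0 ^ n" n "(y - v') * uE 0 ^ n"]
      by (simp_all add: UI.add flip: distrib_right) (simp add: algebra_simps)
    then show ?case by blast
  qed
  obtain c where c: "c \<noteq> 0" "uF 0 ^ n * uE 0 ^ n - uconst c \<in> ?J"
    using weyl_FkEk[of n n] by auto
  obtain v where v: "v \<in> UI" "(uconst (1 / c) * u * uF 0 ^ n - v) * uE 0 ^ n \<in> ?J"
    using P by blast
  have "uconst (1 / c) * u * uconst c = u"
    unfolding mult.assoc uconst_central by (simp add: c flip: mult.assoc uconst_mult)
  then have "u - v * uE 0 ^ n = (uconst (1 / c) * u * uF 0 ^ n - v) * uE 0 ^ n -
      uconst (1 / c) * u * (uF 0 ^ n * uE 0 ^ n - uconst c)"
    by (simp add: left_diff_distrib right_diff_distrib mult.assoc)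
  also have "\<dots> \<in> ?J"
    by (intro subm v c)
  finally show ?thesis using v by blast
qed

section \<open>Annihilators\<close>

primrec fprod :: "(nat \<Rightarrow> fock) \<Rightarrow> nat \<Rightarrow> fock" where
  "fprod a 0 = 1"
| "fprod a (Suc n) = a n * fprod a n"

text \<open>Splits off the factor of index zero, on which I acts in a controlled way.\<close>

lemma fprod_Suc_right: "fprod a (Suc n) = fprod (\<lambda>k. a (Suc k)) n * a 0"
  by (induction n) (simp_all add: mult.assoc)

lemma fshift_fprod: "fshift (fprod (\<lambda>k. flet v (Suc k)) n) = fprod (flet v) n"
  by (induction n) (simp_all add: fshift_mult)

lemma fprod_absorb:
  assumes "fodd v" "k < n"
  shows "flet v k * fprod (flet v) n = 0"
  using assms(2)
proof (induction n)
  case (Suc n)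
  show ?case
  proof (cases "k = n")
    case True
    then show ?thesis
      using flet_odd_sq[OF assms(1)] by (simp flip: mult.assoc)
  next
    case False
    have "flet v k * (flet v n * fprod (flet v) n) = fconst (fsign (fodd v) v) * flet v n * (flet v k * fprod (flet v) n)"
      by (metis flet_swap mult.assoc)
    with False Suc show ?thesis by simp
  qed
qed simp

lemma oder_even_mult: "\<not> osp_odd y \<Longrightarrow> oder y i (u * v) = oder y i u * v + u * oder y i v"
  by (simp add: oder_mult)

lemma oder_one [simp]: "oder y i 1 = 0"
  using oder_const[of y i 1] by simp

lemma oder_funpow_add: "(oder y i ^^ k) (u + v) = (oder y i ^^ k) u + (oder y i ^^ k) v"
  and oder_funpow_cmult: "(oder y i ^^ k) (fconst c * u) = fconst c * (oder y i ^^ k) u"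
  by (induction k) (simp_all add: oder_add oder_cmult)

lemma oder_funpow_mult_const:
  assumes "\<not> osp_odd y" "oder y i a = 0"
  shows "(oder y i ^^ k) (a * z) = a * (oder y i ^^ k) z"
  by (induction k) (simp_all add: assms oder_even_mult)

lemma oder_funpow_mult:
  assumes "\<not> osp_odd y" "oder y i a = b" "oder y i b = 0"
  shows "(oder y i ^^ Suc k) (a * z) = a * (oder y i ^^ Suc k) z + fconst (of_nat (Suc k)) * (b * (oder y i ^^ k) z)"
proof (induction k)
  case 0
  show ?case by (simp add: assms oder_even_mult)
next
  case (Suc k)
  have "(oder y i ^^ Suc (Suc k)) (a * z) = oder y i ((oder y i ^^ Suc k) (a * z))"
    by simp
  also have "\<dots> = a * (oder y i ^^ Suc (Suc k)) z + (1 + fconst (of_nat (Suc k))) * (b * (oder y i ^^ Suc k) z)"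
    unfolding Suc by (simp add: oder_add oder_even_mult[OF assms(1)] assms oder_cmult distrib_right)
  also have "1 + fconst (of_nat (Suc k)) = fconst (of_nat (Suc (Suc k)))"
    unfolding fconst_of_nat by simp
  finally show ?case .
qed

lemma oder_fprod_zero:
  assumes "\<And>k. k < n \<Longrightarrow> oder y i (a k) = 0" "oder y i q = 0"
  shows "oder y i (fprod a n * q) = 0"
  using assms by (induction n) (simp_all add: oder_mult mult.assoc)

text \<open>As \<open>b k\<close> is killed, n derivatives must hit each of the n factors once, in
  n! orders, and one more gives zero.\<close>

lemma oder_string:
  assumes y: "\<not> osp_odd y" and ab: "\<And>k. oder y i (a k) = b k" "\<And>k. oder y i (b k) = 0" and q: "oder y i q = 0"
  shows "(oder y i ^^ n) (fprod a n * q) = fconst (fact n) * (fprod b n * q)"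
    and "(oder y i ^^ Suc n) (fprod a n * q) = 0"
proof -
  have *: "(oder y i ^^ Suc n) (fprod a n * q) = 0"
    if "(oder y i ^^ n) (fprod a n * q) = fconst (fact n) * (fprod b n * q)" for n
    using that oder_fprod_zero[of n y i b q] ab q by (simp add: oder_cmult)
  show one: "(oder y i ^^ n) (fprod a n * q) = fconst (fact n) * (fprod b n * q)"
  proof (induction n)
    case (Suc n)
    have "(oder y i ^^ Suc n) (fprod a (Suc n) * q) = fconst (of_nat (Suc n)) * (b n * (fconst (fact n) * (fprod b n * q)))"
      unfolding fprod.simps mult.assoc oder_funpow_mult[OF y ab] Suc *[OF Suc] by simp
    then show ?case
      by (simp add: fconst_mult mult.assoc fconst_left_commute[of "b n"])
  qed simp
  from *[OF one] show "(oder y i ^^ Suc n) (fprod a n * q) = 0" .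
qed

lemma act_power: "act (u ^ k) z = (act u ^^ k) z"
  by (induction k) (simp_all add: act_mult)

lemma act_gen_power: "act (ugen y i ^ k) z = (oder y i ^^ k) z"
proof -
  have "act (ugen y i) = oder y i"
    by (rule ext) (rule act_gen)
  then show ?thesis by (simp add: act_power)
qed

lemma oder_x_power:
  assumes "oder y i (flet fx 0) = 0"
  shows "oder y i (flet fx 0 ^ j) = 0"
  using assms by (induction j) (simp_all add: oder_mult)

lemma olet_x_zero: "y \<noteq> osp_gp \<Longrightarrow> y \<noteq> osp_gm \<or> 1 \<le> i \<Longrightarrow> oder y i (flet fx 0) = 0"
  by (cases y) (auto simp: oder_let olet_def)

lemma olet_x_zero': "1 \<le> i \<Longrightarrow> oder y i (flet fx 0) = 0"
  by (auto simp: oder_let olet_def)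

lemma psi_oder_x_power: "flet fpsi 0 * oder osp_gm 0 (flet fx 0 ^ j) = 0"
proof (induction j)
  case (Suc j)
  let ?p = "flet fpsi 0" and ?x = "flet fx 0"
  have "?p * oder osp_gm 0 (?x ^ Suc j) = - (?p * ?p) * ?x ^ j + ?p * ?x * oder osp_gm 0 (?x ^ j)"
    by (simp add: oder_mult oder_let olet_def fsign_def fodd_def fconst_minus distrib_left right_diff_distrib mult.assoc)
  also have "?p * ?x * oder osp_gm 0 (?x ^ j) = ?x * (?p * oder osp_gm 0 (?x ^ j))"
    by (simp add: flet_fx_central mult.assoc)
  finally show ?case
    using Suc flet_odd_sq[of fpsi 0] by (simp add: fodd_def)
qed simp

text \<open>These generators kill \<psi>_0, and only g^-_0 moves x_0, producing a second
  \<psi>_0.\<close>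

lemma oder_fq:
  assumes "ugen y i \<in> uigens" "1 \<le> i \<or> y \<in> {osp_f, osp_gm}"
  shows "oder y i (fq j) = 0"
proof (cases "1 \<le> i")
  case True
  then show ?thesis
    by (simp add: fq_def oder_mult oder_x_power olet_x_zero' oder_let olet_def)
next
  case False
  with assms(2) have "i = 0" "y = osp_f \<or> y = osp_gm"
    by auto
  then show ?thesis
    using psi_oder_x_power[of j]
    by (auto simp: fq_def oder_mult oder_x_power olet_x_zero oder_let olet_def fsign_def fodd_def)
qed

text \<open>By \<open>oder_fq\<close> only the Leibniz term on \<open>z\<close> remains:
  multiplication by \<open>fq j\<close> is a map of I-modules.\<close>

lemma UI_act_fq:
  assumes "u \<in> UI"
  shows "act u (z * fq j) = act u z * fq j"
  using assms
proof induction
  case (gen a u)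
  then obtain y i where y: "a = ugen y i" "1 \<le> i \<or> y \<in> {osp_f, osp_gm}"
    by (auto simp: uigens_def)
  then have "oder y i (fq j) = 0"
    using gen oder_fq by metis
  with gen show ?case
    by (simp add: y(1) act_mult act_gen oder_mult)
qed (simp_all add: act_const act_plus distrib_right mult.assoc)

text \<open>Multiplication by \<psi>^+_0 is a map of I-modules only modulo x_0 and \<psi>_0, whose
  left ideal I preserves.\<close>

lemma UI_act_psip:
  assumes "u \<in> UI"
  shows "\<exists>b c. act u (z * flet fpsip 0) = act u z * flet fpsip 0 + b * flet fx 0 + c * flet fpsi 0"
  using assms
proof induction
  case (const c)
  show ?case by (rule exI[of _ 0], rule exI[of _ 0]) (simp add: act_const mult.assoc)
next
  case (gen a u)
  then obtain y i where y: "a = ugen y i" "1 \<le> i \<or> y \<in> {osp_f, osp_gm}"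
    by (auto simp: uigens_def)
  obtain b c where bc: "act u (z * flet fpsip 0) = act u z * flet fpsip 0 + b * flet fx 0 + c * flet fpsi 0"
    using gen by blast
  \<comment> \<open>The only nonzero values are f_0 \<psi>^+_0 = \<psi>_0, g^-_0 \<psi>^+_0 = x_0
    and g^-_0 x_0 = -\<psi>_0.\<close>
  have "\<exists>b c. oder y i (flet v 0) = b * flet fx 0 + c * flet fpsi 0" for v
  proof -
    have "oder y i (flet v 0) \<in> {0, flet fx 0, flet fpsi 0, - flet fpsi 0}"
      using y(2) by (cases v) (auto simp: oder_let olet_def)
    then have "oder y i (flet v 0) \<in> {0 * flet fx 0 + 0 * flet fpsi 0, 1 * flet fx 0 + 0 * flet fpsi 0,
        0 * flet fx 0 + 1 * flet fpsi 0, 0 * flet fx 0 + (- 1) * flet fpsi 0}"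
      by simp
    then show ?thesis by blast
  qed
  then obtain b1 c1 b2 c2 b3 c3 where o: "oder y i (flet fpsip 0) = b1 * flet fx 0 + c1 * flet fpsi 0"
    "oder y i (flet fx 0) = b2 * flet fx 0 + c2 * flet fpsi 0"
    "oder y i (flet fpsi 0) = b3 * flet fx 0 + c3 * flet fpsi 0"
    by metis
  let ?s = "fpar (osp_odd y)"
  have "act (a * u) (z * flet fpsip 0) = act (a * u) z * flet fpsip 0 +
     (?s (act u z) * b1 + oder y i b + ?s b * b2 + ?s c * b3) * flet fx 0 +
     (?s (act u z) * c1 + ?s b * c2 + oder y i c + ?s c * c3) * flet fpsi 0"
    by (simp add: y(1) act_mult act_gen bc oder_add oder_mult o distrib_left distrib_right mult.assoc)
  then show ?case by blast
next
  case (add u v)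
  then obtain b c b' c' where "act u (z * flet fpsip 0) = act u z * flet fpsip 0 + b * flet fx 0 + c * flet fpsi 0"
    "act v (z * flet fpsip 0) = act v z * flet fpsip 0 + b' * flet fx 0 + c' * flet fpsi 0"
    by blast
  then have "act (u + v) (z * flet fpsip 0) = act (u + v) z * flet fpsip 0 + (b + b') * flet fx 0 + (c + c') * flet fpsi 0"
    by (simp add: act_plus distrib_right)
  then show ?case by blast
qed

lemma fshift_act: "fshift (act u z) = act u (fshift z)"
  by (induction u rule: uosp_induct)
    (simp_all add: act_const act_mult act_gen act_plus fshift_mult fshift_add fshift_oder)

section \<open>Action on products of odd variables\<close>

abbreviation "psis \<equiv> fprod (flet fpsi)"
abbreviation "psips \<equiv> fprod (flet fpsip)"
abbreviation "xpow j \<equiv> flet fx 0 ^ j"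

lemma xpow_central: "z * xpow j = xpow j * z"
  by (induction j) (simp_all add: mult.assoc, metis flet_fx_central mult.assoc)

lemma psis_xpow: "psis (Suc m) * xpow j = fprod (\<lambda>k. flet fpsi (Suc k)) m * fq j"
  unfolding fprod_Suc_right fq_def by (simp add: mult.assoc)

lemma act_F_psips: "act (uF 0 ^ n) (psips n * xpow j) = fconst (fact n) * (psis n * xpow j)"
  "act (uF 0 ^ Suc n) (psips n * xpow j) = 0"
  unfolding act_gen_power
  by (rule oder_string[where b = "flet fpsi"]; simp add: oder_let olet_def oder_x_power olet_x_zero)+

lemma act_E_psis: "act (uE 0 ^ n) (psis n * xpow j) = fconst (fact n) * (psips n * xpow j)"
  "act (uE 0 ^ Suc n) (psis n * xpow j) = 0"
  unfolding act_gen_power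
  by (rule oder_string[where b = "flet fpsip"]; simp add: oder_let olet_def oder_x_power olet_x_zero)+

text \<open>e_1 sends \<psi>_{k+1} to \<psi>^+_k and kills \<psi>_0 x_0^j, so
  \<open>oder_string\<close> applies to the other m factors.\<close>

lemma act_E1_psis: "act (uE 1 ^ m) (psis (Suc m) * xpow j) = fconst (fact m) * (psips m * fq j)"
  "act (uE 1 ^ Suc m) (psis (Suc m) * xpow j) = 0"
proof -
  have q: "oder osp_e 1 (fq j) = 0"
    by (intro oder_fq) (auto simp: uigens_def)
  note str = oder_string[where b = "flet fpsip", OF _ _ _ q]
  show "act (uE 1 ^ m) (psis (Suc m) * xpow j) = fconst (fact m) * (psips m * fq j)"
    unfolding act_gen_power psis_xpow by (rule str(1); simp add: oder_let olet_def)
  show "act (uE 1 ^ Suc m) (psis (Suc m) * xpow j) = 0"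
    unfolding act_gen_power psis_xpow by (rule str(2); simp add: oder_let olet_def)
qed

text \<open>h_i turns a factor into a multiple of one of lower index, which already occurs further
  right and squares to zero.\<close>

lemma oder_h_fprod:
  assumes "fodd v" "1 \<le> i" "oder osp_h i q = 0"
  shows "oder osp_h i (fprod (flet v) n * q) = 0"
proof -
  have "oder osp_h i (fprod (flet v) n) = 0"
  proof (induction n)
    case (Suc n)
    have "oder osp_h i (flet v n) * fprod (flet v) n = 0"
      using assms(2) fprod_absorb[OF assms(1), of "n - i" n]
      by (auto simp: oder_let olet_def mult.assoc)
    then show ?case
      by (simp add: oder_mult Suc)
  qed simp
  then show ?thesis
    by (simp add: oder_mult assms)
qed

lemma Bplus_psips:
  assumes "r \<in> Bplus" "q = xpow j \<or> q = fq j"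
  shows "act r (psips m * q) = 0"
proof -
  obtain y i where r: "r = ugen y i" "y \<in> {osp_e, osp_gp, osp_h}" "1 \<le> i"
    using assms by (auto simp: Bplus_def)
  have "oder y i q = 0"
    using assms(2) r oder_fq[of y i j] oder_x_power[OF olet_x_zero'] by (auto simp: uigens_def)
  then show ?thesis
  proof (cases "y = osp_h")
    case True
    with r \<open>oder y i q = 0\<close> show ?thesis
      by (simp add: act_gen oder_h_fprod fodd_def)
  next
    case False
    with r have "oder y i (flet fpsip k) = 0" for k
      by (auto simp: oder_let olet_def)
    with r \<open>oder y i q = 0\<close> show ?thesis
      by (simp add: act_gen oder_fprod_zero)
  qed
qed

text \<open>Since g^-_0 x_0 = -\<psi>_0, a positive power of x_0 is killed only next to a factor
  \<psi>_0, hence \<open>mj\<close>.\<close>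

lemma Bminus_psis:
  assumes r: "r \<in> Bminus" and mj: "m > 0 \<or> j = 0"
  shows "act r (psis m * xpow j) = 0"
proof -
  obtain y i where y: "r = ugen y i" "y \<in> {osp_f, osp_gm, osp_h}" "1 \<le> i \<or> y \<noteq> osp_h"
    using r by (auto simp: Bminus_def)
  show ?thesis
  proof (cases "y = osp_h")
    case True
    with y show ?thesis
      by (simp add: act_gen oder_h_fprod fodd_def oder_x_power olet_x_zero')
  next
    case False
    then have *: "oder y i (flet fpsi k) = 0" for k
      using y(2) by (auto simp: oder_let olet_def)
    show ?thesis
    proof (cases m)
      case 0
      with mj y(1) show ?thesis by (simp add: act_gen)
    next
      case (Suc k)
      have "oder y i (fq j) = 0"
        using y False by (intro oder_fq) (auto simp: uigens_def)
      then show ?thesis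
        unfolding Suc psis_xpow y(1) act_gen by (intro oder_fprod_zero *)
    qed
  qed
qed

lemma psips_fq: "psips m * fq j = psips m * xpow j * fq 0"
  by (simp add: fq_def mult.assoc xpow_central[of "flet fpsi 0"])

text \<open>g^-_0 turns one \<psi>^+ into x, and f_0^k the other k into \<psi>. Next to \<psi>_0
  only the term in which \<psi>^+_0 becomes x_0 survives; the sign comes from passing g^-_0 over k
  odd variables.\<close>

lemma act_FG_psips:
  "act (uF 0 ^ k * uGm 0) (psips (Suc k) * fq j) =
     fconst ((-1) ^ k * fact k) * (psis (Suc k) * xpow (Suc j))"
proof -
  let ?f = "oder osp_f 0" and ?g = "oder osp_gm 0"
  let ?R = "\<lambda>k. fprod (\<lambda>i. flet fpsi (Suc i)) k"
  have psq: "psis (Suc k) * fq j = 0" for k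
    unfolding fprod_Suc_right fq_def mult.assoc
    using flet_odd_sq[of fpsi 0] by (simp add: fodd_def mult.assoc[of "flet fpsi 0", symmetric])
  have comm: "(?f ^^ k) (?g z) = ?g ((?f ^^ k) z)" for k z
  proof -
    have "act (uGm 0 * uF 0 ^ k) z = act (uF 0 ^ k * uGm 0) z"
      by (simp only: uF_uGm_power)
    then show ?thesis
      by (simp add: act_mult act_gen_power act_gen)
  qed
  \<comment> \<open>In the step, the term with the leftmost factor turned into x dies by
    \<open>psq\<close>. In the other, exactly one f_0 hits that factor, as \<open>Suc k\<close> of
    them annihilate the rest.\<close>
  have main: "(?f ^^ k) (?g (psips (Suc k))) * fq j = fconst ((-1) ^ k * fact k) * (?R k * flet fx 0 * fq j)"
  proof (induction k)
    case 0
    show ?case by (simp add: oder_let olet_def)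
  next
    case (Suc k)
    let ?A = "psips (Suc k)" and ?n = "Suc k"
    have F: "(?f ^^ Suc k) ?A = fconst (fact (Suc k)) * psis (Suc k)"
      using act_F_psips(1)[of "Suc k" 0] by (simp only: act_gen_power power_0 mult_1_right)
    have "?g (psips (Suc ?n)) = flet fx ?n * ?A + fconst (-1) * (flet fpsip ?n * ?g ?A)"
      unfolding fprod.simps(2)[of _ ?n] oder_mult by (simp add: oder_let olet_def fsign_def fodd_def)
    then have "(?f ^^ ?n) (?g (psips (Suc ?n))) =
        (?f ^^ ?n) (flet fx ?n * ?A) + fconst (-1) * (?f ^^ ?n) (flet fpsip ?n * ?g ?A)"
      by (simp only: oder_funpow_add oder_funpow_cmult)
    also have "(?f ^^ ?n) (flet fx ?n * ?A) = flet fx ?n * (?f ^^ ?n) ?A"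
      by (intro oder_funpow_mult_const) (simp_all add: oder_let olet_def)
    also have "\<dots> = fconst (fact ?n) * (flet fx ?n * psis ?n)"
      unfolding F by (rule fconst_left_commute)
    also have "(?f ^^ ?n) (flet fpsip ?n * ?g ?A) =
        flet fpsip ?n * (?f ^^ ?n) (?g ?A) + fconst (of_nat ?n) * (flet fpsi ?n * (?f ^^ k) (?g ?A))"
      by (intro oder_funpow_mult) (simp_all add: oder_let olet_def)
    also have "(?f ^^ ?n) (?g ?A) = 0"
    proof -
      have "?g (psis ?n * 1) = 0"
        by (intro oder_fprod_zero) (simp_all add: oder_let olet_def)
      then show ?thesis
        unfolding comm F by (simp add: oder_cmult del: fprod.simps)
    qed
    finally have "(?f ^^ ?n) (?g (psips (Suc ?n))) * fq j = fconst (fact ?n) * (flet fx ?n * (psis ?n * fq j)) +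
        fconst (-1) * (fconst (of_nat ?n) * (flet fpsi ?n * ((?f ^^ k) (?g ?A) * fq j)))"
      by (simp only: mult_zero_right add_0_left distrib_right mult.assoc)
    also have "\<dots> = fconst (-1) * (fconst (of_nat ?n) * (flet fpsi ?n * (fconst ((-1) ^ k * fact k) * (?R k * flet fx 0 * fq j))))"
      unfolding Suc psq by simp
    also have "\<dots> = fconst ((-1) ^ ?n * fact ?n) * (?R ?n * flet fx 0 * fq j)"
      by (simp add: mult.assoc fconst_left_commute[of "flet fpsi ?n"] fconst_mult fconst_minus
          del: of_nat_Suc) (metis fconst_left_commute)
    finally show ?case .
  qed
  have "flet fx 0 * fq j = flet fpsi 0 * xpow (Suc j)"
    unfolding fq_def by (metis flet_fx_central mult.assoc power_Suc)
  then have "?R k * flet fx 0 * fq j = psis (Suc k) * xpow (Suc j)"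
    unfolding fprod_Suc_right mult.assoc by simp
  moreover have "act (uF 0 ^ k * uGm 0) (psips (Suc k) * fq j) = (?f ^^ k) (?g (psips (Suc k))) * fq j"
    by (subst UI_act_fq) (simp_all add: UI_mult act_mult act_gen_power act_gen del: fprod.simps)
  ultimately show ?thesis
    using main by simp
qed

section \<open>Base cases and the extension argument\<close>

lemma fconst_cancel: "c \<noteq> 0 \<Longrightarrow> fconst c * z = 0 \<Longrightarrow> z = 0"
proof -
  assume "c \<noteq> 0" "fconst c * z = 0"
  then have "fconst (1 / c) * (fconst c * z) = 0" by simp
  then show "z = 0" using \<open>c \<noteq> 0\<close> by (simp flip: mult.assoc fconst_mult)
qed

lemma act_cancel: "c \<noteq> 0 \<Longrightarrow> act u (fconst c * z) = 0 \<Longrightarrow> act u z = 0"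
  by (simp add: act_cmult) (rule fconst_cancel)

text \<open>If all generators of I kill a cyclic vector, it spans its module; this serves the base
  cases.\<close>

lemma UI_augment:
  assumes L: "ui_submod L" and gens: "uigens \<subseteq> L" and u: "u \<in> UI"
  shows "\<exists>c. u - uconst c \<in> L"
  using u
proof induction
  case (const c)
  show ?case by (rule exI[of _ c]) (simp add: subm_zero[OF L])
next
  case (gen a u)
  then obtain c where c: "u - uconst c \<in> L" by blast
  have "a * u - uconst 0 = a * (u - uconst c) + uconst c * a"
    by (simp add: right_diff_distrib uconst_central)
  also have "\<dots> \<in> L"
    using c gen gens by (intro subm_add[OF L] subm_mult[OF L] UI.const uigens_UI) auto
  finally show ?case by blast
next
  case (add u v)
  then obtain c d where "u - uconst c \<in> L" "v - uconst d \<in> L" by blast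
  then have "u + v - uconst (c + d) \<in> L"
    using subm_add[OF L, of "u - uconst c" "v - uconst d"] by (simp add: uconst_add algebra_simps)
  then show ?case by blast
qed

text \<open>The remaining generators are brackets: [h_{i-1},e_1] = 2 e_i and [g^-_{i-1},e_1] =
  g^+_i.\<close>

lemma uigens_subset_minus:
  assumes L: "ui_submod L" and B: "insert (uE 1) Bminus \<subseteq> L"
  shows "uigens \<subseteq> L"
proof
  note subm = subm_diff[OF L] subm_mult[OF L]
  fix a assume "a \<in> uigens"
  then obtain y i where a: "a = ugen y i" "1 \<le> i \<or> y \<in> {osp_f, osp_gm}"
    by (auto simp: uigens_def)
  have BL: "uF j \<in> L" "uGm j \<in> L" "1 \<le> j \<Longrightarrow> uH j \<in> L" "uE 1 \<in> L" for j
    using B by (force simp: Bminus_def)+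
  show "a \<in> L"
  proof (cases y)
    case osp_e
    show ?thesis
    proof (cases "i = 1")
      case False
      with osp_e a have i: "1 \<le> i - 1" "i - 1 + 1 = i" by auto
      have "2 * uE i = uH (i - 1) * uE 1 - uE 1 * uH (i - 1)"
        unfolding osp_rels(3) i by simp
      also have "\<dots> \<in> L"
        using i by (intro subm BL UI_ugen) simp_all
      finally show ?thesis
        using subm_two[OF L] a osp_e by simp
    qed (use BL a osp_e in simp)
  next
    case osp_gp
    with a have i: "i - 1 + 1 = i" by auto
    have "uGp i = uGm (i - 1) * uE 1 - uE 1 * uGm (i - 1)"
      unfolding osp_rels(12) i by simp
    also have "\<dots> \<in> L"
      by (intro subm BL UI_ugen) simp_all
    finally show ?thesis
      using a osp_gp by simp
  qed (use a BL in auto)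
qed

text \<open>[g^-_0,h_j] gives g^-_j, and then [g^-_j,g^-_0]_+ gives f_j.\<close>

lemma uigens_subset_plus:
  assumes L: "ui_submod L" and B: "insert (uGm 0) Bplus \<subseteq> L"
  shows "uigens \<subseteq> L"
proof
  note subm = subm_diff[OF L] subm_mult[OF L] subm_uminus[OF L]
  fix a assume "a \<in> uigens"
  then obtain y i where a: "a = ugen y i" "1 \<le> i \<or> y \<in> {osp_f, osp_gm}"
    by (auto simp: uigens_def)
  have BL: "1 \<le> j \<Longrightarrow> uE j \<in> L" "1 \<le> j \<Longrightarrow> uGp j \<in> L" "1 \<le> j \<Longrightarrow> uH j \<in> L" "uGm 0 \<in> L" for j
    using B by (force simp: Bplus_def)+
  have G: "uGm j \<in> L" for j
  proof (cases "j = 0")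
    case False
    have "uGm j = uGm 0 * uH j - uH j * uGm 0"
      by (simp add: osp_rels(6))
    also have "\<dots> \<in> L"
      using False by (intro subm BL UI_ugen) simp_all
    finally show ?thesis .
  qed (use BL in simp)
  have F: "uF j \<in> L" for j
  proof -
    have "2 * uF j = - (uGm 0 * uGm j) - uGm j * uGm 0"
      by (simp add: osp_rels(9)[of j 0])
    also have "\<dots> \<in> L"
      by (intro subm G UI_ugen)
    finally show ?thesis
      by (rule subm_two[OF L])
  qed
  show "a \<in> L"
    using a BL G F by (cases y) auto
qed

lemma ui_ideal_mono: "x \<in> ui_ideal R \<Longrightarrow> R \<subseteq> S \<Longrightarrow> x \<in> ui_ideal S"
  by (induction rule: ui_ideal.induct) (auto intro: ui_ideal.intros)

text \<open>Write u = k + v q with k generated by \<open>R\<close>. Then \<open>v\<close> kills q z,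
  a nonzero multiple of z', so it is generated by \<open>T\<close>, and \<open>T\<close> takes
  \<open>q\<close> into the relations with \<open>q'\<close>. In module terms, an extension has no
  further relations if its quotient and its submodule have none.\<close>

lemma annihilator_step:
  assumes u: "u \<in> ui_ideal (insert q R)" and z: "act u z = 0"
    and R: "\<And>r. r \<in> R \<Longrightarrow> act r z = 0"
    and q: "act q z = fconst c * z'" "c \<noteq> 0"
    and next_ann: "\<And>v. v \<in> UI \<Longrightarrow> act v z' = 0 \<Longrightarrow> v \<in> ui_ideal T"
    and T: "\<And>t. t \<in> T \<Longrightarrow> t * q \<in> ui_ideal (insert q' R)"
  shows "u \<in> ui_ideal (insert q' R)"
proof -
  obtain k v where kv: "k \<in> ui_ideal R" "v \<in> UI" "u = k + v * q"
    using ui_ideal_insert[OF u] by blast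
  have "act k z = 0"
    using R kv(1) by (rule ui_ideal_act)
  with z kv(3) have "act v (fconst c * z') = 0"
    by (simp add: act_plus act_mult q)
  then have "act v z' = 0"
    by (rule act_cancel[OF q(2)])
  with kv(2) have "v \<in> ui_ideal T"
    by (rule next_ann)
  then have "v * q \<in> ui_ideal (insert q' R)"
    using ui_ideal_mult_right[OF ui_submod_ideal T] by blast
  moreover have "k \<in> ui_ideal (insert q' R)"
    using kv(1) by (rule ui_ideal_mono) blast
  ultimately show ?thesis
    unfolding kv(3) by (intro ui_ideal.add)
qed

text \<open>The three kinds of \<open>I\<close>-modules: a vector in each family has no further relations because the
  quotient by the extremal submodule and that submodule have none.\<close>

definition ann_minus :: "nat \<Rightarrow> bool" where
  "ann_minus m \<longleftrightarrow> (\<forall>j. \<forall>u\<in>UI. act u (psis (Suc m) * xpow j) = 0 \<longrightarrow> u \<in> ui_ideal (insert (uE 1 ^ Suc m) Bminus))"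

definition ann_odd :: "nat \<Rightarrow> bool" where
  "ann_odd m \<longleftrightarrow> (\<forall>j. \<forall>u\<in>UI. act u (psips (Suc m) * fq j) = 0 \<longrightarrow> u \<in> ui_ideal (insert (uF 0 ^ Suc m) Bplus))"

text \<open>For m = 0 and j > 0 the vector x_0^j is not killed by g^-_0; the guard excludes this
  case.\<close>

definition ann_even :: "nat \<Rightarrow> bool" where
  "ann_even m \<longleftrightarrow> (\<forall>j. \<forall>u\<in>UI. m > 0 \<or> j = 0 \<longrightarrow> act u (psips m * xpow j) = 0 \<longrightarrow> u \<in> ui_ideal (insert (uF 0 ^ m * uGm 0) Bplus))"

lemma fconst_eq_0: "fconst c = 0 \<Longrightarrow> c = 0"
  using fconst_cancel[of c 1] by auto

text \<open>The relations contain all generators of I, so \<open>u\<close> is a constant c modulo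
  them, and c \<psi>_0 x_0^j = 0 forces c = 0.\<close>

lemma ann_minus_0: "ann_minus 0"
  unfolding ann_minus_def
proof (intro allI ballI impI)
  fix j u
  assume u: "u \<in> UI" "act u (psis (Suc 0) * xpow j) = 0"
  let ?K = "ui_ideal (insert (uE 1 ^ Suc 0) Bminus)"
  have "uigens \<subseteq> ?K"
    by (rule uigens_subset_minus[OF ui_submod_ideal]) (simp add: subset_iff ui_ideal.gen)
  then obtain c where c: "u - uconst c \<in> ?K"
    using UI_augment[OF ui_submod_ideal _ u(1)] by blast
  have "act (u - uconst c) (psis (Suc 0) * xpow j) = 0"
    by (rule ui_ideal_act[OF _ c]) (use Bminus_psis[of _ "Suc 0" j] act_E1_psis(2)[of 0 j] in auto)
  with u(2) have "fconst c * fq j = 0"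
    by (simp add: act_minus act_const fq_def)
  then obtain b d where "fconst c = b * flet fx 0 + d * flet fpsi 0"
    using fq_zero_divisor by blast
  then have "fshift (fconst c) = 0"
    by (simp add: fshift_add fshift_mult)
  then have "c = 0"
    by (simp add: fconst_eq_0)
  with c show "u \<in> ?K" by simp
qed

lemma ann_even_0: "ann_even 0"
  unfolding ann_even_def
proof (intro allI ballI impI)
  fix j u
  assume u: "u \<in> UI" "act u (psips 0 * xpow j) = 0" "0 < (0::nat) \<or> j = 0"
  let ?K = "ui_ideal (insert (uF 0 ^ 0 * uGm 0) Bplus)"
  have "uigens \<subseteq> ?K"
    by (rule uigens_subset_plus[OF ui_submod_ideal]) (simp add: subset_iff ui_ideal.gen)
  then obtain c where c: "u - uconst c \<in> ?K"
    using UI_augment[OF ui_submod_ideal _ u(1)] by blast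
  have "act (u - uconst c) 1 = 0"
    by (rule ui_ideal_act[OF _ c]) (auto simp: Bplus_def act_gen)
  with u have "fconst c = 0"
    by (simp add: act_minus act_const)
  then have "c = 0"
    by (rule fconst_eq_0)
  with c show "u \<in> ?K" by simp
qed

text \<open>Quotient: stripping \<psi>_0 x_0^j and \<psi>^+_0 and shifting indices leads to the
  vector of \<open>ann_even m\<close>. Submodule: by \<open>act_FG_psips\<close> it is of minus
  kind, with exponent j + 1.\<close>

lemma ann_odd_step:
  assumes "ann_even m" "ann_minus m"
  shows "ann_odd m"
  unfolding ann_odd_def
proof (intro allI ballI impI)
  fix j u
  assume u: "u \<in> UI" "act u (psips (Suc m) * fq j) = 0"
  let ?Y = "fprod (\<lambda>k. flet fpsip (Suc k)) m"
  have "act u (psips (Suc m)) * fq j = 0"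
    using u UI_act_fq by metis
  then obtain b c where bc: "act u (psips (Suc m)) = b * flet fx 0 + c * flet fpsi 0"
    using fq_zero_divisor by blast
  obtain b' c' where "act u (?Y * flet fpsip 0) = act u ?Y * flet fpsip 0 + b' * flet fx 0 + c' * flet fpsi 0"
    using UI_act_psip[OF u(1)] by blast
  with bc have "act u ?Y * flet fpsip 0 = (b - b') * flet fx 0 + (c - c') * flet fpsi 0"
    unfolding fprod_Suc_right by (simp add: algebra_simps)
  \<comment> \<open>Exponent zero is the one that \<open>ann_even\<close> admits also for m =
    0.\<close>
  then have "act u (psips m * xpow 0) = 0"
    using fshift_zero_of_psip by (fastforce simp: fshift_act fshift_fprod)
  then have "u \<in> ui_ideal (insert (uF 0 ^ m * uGm 0) Bplus)"
    using assms(1) u(1) unfolding ann_even_def by blast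
  then show "u \<in> ui_ideal (insert (uF 0 ^ Suc m) Bplus)"
  proof (rule annihilator_step[OF _ u(2) _ act_FG_psips])
    show "act r (psips (Suc m) * fq j) = 0" if "r \<in> Bplus" for r
      using Bplus_psips that by blast
    show "v \<in> ui_ideal (insert (uE 1 ^ Suc m) Bminus)" if "v \<in> UI" "act v (psis (Suc m) * xpow (Suc j)) = 0" for v
      using assms(2) that unfolding ann_minus_def by blast
    show "t * (uF 0 ^ m * uGm 0) \<in> ui_ideal (insert (uF 0 ^ Suc m) Bplus)" if "t \<in> insert (uE 1 ^ Suc m) Bminus" for t
      using that by (intro plus_to_minus_odd[OF ui_submod_ideal]) (auto intro: ui_ideal.gen)
  qed simp
qed

text \<open>Quotient: multiplication by \<psi>_0 leads to the vector of \<open>ann_odd m\<close>.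
  Submodule: f_0^{m+1} leads to that of \<open>ann_minus m\<close>.\<close>

lemma ann_even_step:
  assumes "ann_odd m" "ann_minus m"
  shows "ann_even (Suc m)"
  unfolding ann_even_def
proof (intro allI ballI impI)
  fix j u
  assume u: "u \<in> UI" "act u (psips (Suc m) * xpow j) = 0"
  have "act u (psips (Suc m) * fq j) = 0"
    unfolding psips_fq UI_act_fq[OF u(1)] u(2) by simp
  then have "u \<in> ui_ideal (insert (uF 0 ^ Suc m) Bplus)"
    using assms(1) u(1) unfolding ann_odd_def by blast
  then show "u \<in> ui_ideal (insert (uF 0 ^ Suc m * uGm 0) Bplus)"
  proof (rule annihilator_step[OF _ u(2) _ act_F_psips(1)])
    show "act r (psips (Suc m) * xpow j) = 0" if "r \<in> Bplus" for r
      using Bplus_psips that by blast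
    show "v \<in> ui_ideal (insert (uE 1 ^ Suc m) Bminus)" if "v \<in> UI" "act v (psis (Suc m) * xpow j) = 0" for v
      using assms(2) that unfolding ann_minus_def by blast
    show "t * uF 0 ^ Suc m \<in> ui_ideal (insert (uF 0 ^ Suc m * uGm 0) Bplus)" if "t \<in> insert (uE 1 ^ Suc m) Bminus" for t
      using that by (intro plus_to_minus_even[OF ui_submod_ideal]) (auto intro: ui_ideal.gen)
  qed (rule fact_nonzero)
qed

text \<open>Quotient: stripping \<psi>_0 x_0^j and shifting indices leaves the same kind with one
  factor fewer. Submodule: e_1^{m+1} leads to the odd kind.\<close>

lemma ann_minus_step:
  assumes "ann_odd m" "ann_minus m"
  shows "ann_minus (Suc m)"
  unfolding ann_minus_def
proof (intro allI ballI impI)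
  fix j u
  assume u: "u \<in> UI" "act u (psis (Suc (Suc m)) * xpow j) = 0"
  let ?Y = "fprod (\<lambda>k. flet fpsi (Suc k)) (Suc m)"
  have "act u ?Y * fq j = 0"
    using u psis_xpow UI_act_fq by metis
  then obtain b c where "act u ?Y = b * flet fx 0 + c * flet fpsi 0"
    using fq_zero_divisor by blast
  then have "fshift (act u ?Y) = 0"
    by (simp add: fshift_add fshift_mult)
  then have "act u (psis (Suc m) * xpow 0) = 0"
    unfolding fshift_act fshift_fprod by simp
  then have "u \<in> ui_ideal (insert (uE 1 ^ Suc m) Bminus)"
    using assms(2) u(1) unfolding ann_minus_def by blast
  then show "u \<in> ui_ideal (insert (uE 1 ^ Suc (Suc m)) Bminus)"
  proof (rule annihilator_step[OF _ u(2) _ act_E1_psis(1)])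
    show "act r (psis (Suc (Suc m)) * xpow j) = 0" if "r \<in> Bminus" for r
      using Bminus_psis that by blast
    show "v \<in> ui_ideal (insert (uF 0 ^ Suc m) Bplus)" if "v \<in> UI" "act v (psips (Suc m) * fq j) = 0" for v
      using assms(1) that unfolding ann_odd_def by blast
    show "t * uE 1 ^ Suc m \<in> ui_ideal (insert (uE 1 ^ Suc (Suc m)) Bminus)" if "t \<in> insert (uF 0 ^ Suc m) Bplus" for t
      using that by (intro minus_to_plus[OF ui_submod_ideal]) (auto intro: ui_ideal.gen)
  qed (rule fact_nonzero)
qed

lemma ann_even: "ann_even m"
proof -
  \<comment> \<open>The odd kind at \<open>m\<close> is derived from this pair inside the
    step.\<close>
  have "ann_even m \<and> ann_minus m"
  proof (induction m)
    case (Suc m)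
    then show ?case
      using ann_odd_step ann_even_step ann_minus_step by blast
  qed (simp add: ann_even_0 ann_minus_0)
  then show ?thesis ..
qed

section \<open>Weyl modules realized by explicit vectors, and the embedding\<close>

lemma act_H0_psis: "act (uH 0) (psis n * xpow j) = fconst (- of_nat n) * (psis n * xpow j)"
proof (induction n)
  case (Suc n)
  have "oder osp_h 0 (flet fpsi n) = - flet fpsi n"
    by (simp add: oder_let olet_def)
  then have "act (uH 0) (psis (Suc n) * xpow j) =
      - (psis (Suc n) * xpow j) + flet fpsi n * act (uH 0) (psis n * xpow j)"
    unfolding act_gen fprod.simps mult.assoc by (simp add: oder_even_mult[of osp_h _ "flet fpsi n"])
  also have "\<dots> = (-1 + fconst (- of_nat n)) * (psis (Suc n) * xpow j)"
    unfolding Suc by (simp add: left_diff_distrib distrib_right mult.assoc fconst_left_commute[of "flet fpsi n"])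
  also have "-1 + fconst (- of_nat n) = fconst (- of_nat (Suc n))"
    using fconst_add[of "-1" "- of_nat n"] by simp
  finally show ?case .
qed (simp add: act_gen oder_x_power olet_x_zero)

text \<open>The Weyl module is isomorphic to the submodule generated by
  \<open>\<psi>\<^sub>n\<^sub>-\<^sub>1 \<cdots> \<psi>\<^sub>0 x\<^sub>0\<^sup>j\<close>. The exponent \<open>j = 0\<close> gives the target of the embedding, \<open>j = 1\<close> its image.\<close>

lemma weyl_J_eq_annihilator:
  assumes nj: "n > 0 \<or> j = 0"
  shows "u \<in> weyl_J n \<longleftrightarrow> act u (psis n * xpow j) = 0"
proof
  have kill: "act k (psis n * xpow j) = 0" if "k \<in> weyl_J n" for k
    using that unfolding weyl_J_def
  proof induction
    case (gen s)
    have "s \<in> Bminus \<or> s = uH 0 - uconst (- of_nat n) \<or> s = uE 0 ^ Suc n"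
      using gen by (auto simp: weyl_rels_def Bminus_def)
    then show ?case
      using Bminus_psis[OF _ nj] act_H0_psis[of n j] act_E_psis(2)[of n j]
      by (auto simp: act_minus act_const)
  qed (simp_all add: act_plus act_mult)
  then show "u \<in> weyl_J n \<Longrightarrow> act u (psis n * xpow j) = 0" .
  assume u: "act u (psis n * xpow j) = 0"
  \<comment> \<open>This reduces the claim to elements of I acting on the top vector, where
    \<open>ann_even\<close> applies.\<close>
  obtain v where v: "v \<in> UI" "u - v * uE 0 ^ n \<in> weyl_J n"
    using weyl_generated_by_top by blast
  from kill[OF v(2)] u have "act v (fconst (fact n) * (psips n * xpow j)) = 0"
    by (simp add: act_minus act_mult act_E_psis)
  then have "act v (psips n * xpow j) = 0"
    by (rule act_cancel[rotated]) simp
  then have "v \<in> ui_ideal (insert (uF 0 ^ n * uGm 0) Bplus)"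
    using ann_even[of n] v(1) nj unfolding ann_even_def by blast
  then have "v * uE 0 ^ n \<in> weyl_J n"
    using ui_ideal_mult_right[OF weyl_J_submod zero_to_plus] by blast
  with v(2) show "u \<in> weyl_J n"
    using weyl_J_closed(2) by fastforce
qed

text \<open>g^+_n sends \<psi>_n to x_0 and kills all \<psi>_k with k < n.\<close>

lemma act_Gp_psis: "act (uGp n) (psis (Suc n)) = psis n * xpow 1"
proof -
  have "oder osp_gp n (psis n * 1) = 0"
    by (intro oder_fprod_zero) (simp_all add: oder_let olet_def)
  then show ?thesis
    by (simp add: act_gen oder_mult oder_let olet_def flet_fx_central)
qed

text \<open>The map is right multiplication by \<open>g\<close> on cosets; one direction of the
  equivalence makes it well defined, the other injective.\<close>

lemma weyl_embedding_of_iff: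
  assumes g: "\<And>u. u \<in> weyl_J m \<longleftrightarrow> u * g \<in> weyl_J n"
  shows "\<exists>\<phi>. weyl_embedding m n \<phi> \<and> \<phi> (weyl_gen m) = weyl_act n g (weyl_gen n)"
proof -
  define \<phi> where "\<phi> X = qcoset (weyl_J n) ((SOME a. X = qcoset (weyl_J m) a) * g)" for X
  have eq: "qcoset (weyl_J k) a = qcoset (weyl_J k) b \<longleftrightarrow> a - b \<in> weyl_J k" for k a b
    unfolding weyl_J_def by (rule qcoset_eq_iff)
  have \<phi>: "\<phi> (qcoset (weyl_J m) a) = qcoset (weyl_J n) (a * g)" for a
  proof -
    let ?b = "SOME b. qcoset (weyl_J m) a = qcoset (weyl_J m) b"
    have "qcoset (weyl_J m) a = qcoset (weyl_J m) ?b"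
      by (rule someI) simp
    then have "?b - a \<in> weyl_J m"
      using eq by metis
    then have "?b * g - a * g \<in> weyl_J n"
      unfolding g left_diff_distrib .
    then show ?thesis
      unfolding \<phi>_def eq .
  qed
  have act: "weyl_act k u (qcoset (weyl_J k) a) = qcoset (weyl_J k) (u * a)" for k u a
    unfolding weyl_act_def weyl_J_def by (rule qact_qcoset)
  have add: "weyl_add k (qcoset (weyl_J k) a) (qcoset (weyl_J k) b) = qcoset (weyl_J k) (a + b)" for k a b
    unfolding weyl_add_def weyl_J_def by (rule qadd_qcoset)
  have "weyl_embedding m n \<phi>"
    unfolding weyl_embedding_def weyl_def qcarrier_def inj_on_def
    by (auto simp: \<phi> act add weyl_scale_def eq g left_diff_distrib distrib_right mult.assoc)
  moreover have "\<phi> (weyl_gen m) = weyl_act n g (weyl_gen n)"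
    by (simp add: weyl_gen_def \<phi> act)
  ultimately show ?thesis by blast
qed

theorem lemma1p15:
  fixes n :: nat
  assumes "n > 0"
  shows "\<exists>\<phi>. weyl_embedding n (n + 1) \<phi> \<and>
             \<phi> (weyl_gen n) = weyl_act (n + 1) (ugen osp_gp n) (weyl_gen (n + 1))"
proof (rule weyl_embedding_of_iff)
  fix u
  \<comment> \<open>Positivity of n enters through the factor x_0, which g^-_0 does not kill when no
    \<psi>_0 stands next to it.\<close>
  have "u \<in> weyl_J n \<longleftrightarrow> act u (psis n * xpow 1) = 0"
    using assms by (intro weyl_J_eq_annihilator) simp
  also have "\<dots> \<longleftrightarrow> act (u * uGp n) (psis (n + 1) * xpow 0) = 0"
    by (simp add: act_mult act_Gp_psis del: fprod.simps)
  also have "\<dots> \<longleftrightarrow> u * uGp n \<in> weyl_J (n + 1)"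
    by (intro weyl_J_eq_annihilator[symmetric]) simp
  finally show "u \<in> weyl_J n \<longleftrightarrow> u * uGp n \<in> weyl_J (n + 1)" .
qed

end
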